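(* For every $k, r \in \mathbb{N}$ and every Souslin measurable $c : \mathrm{FIN}_{\pm k}^{[\infty]} \rightarrow r$ there are $i < r$ and an infinite block sequence $P \in \mathrm{FIN}_{\pm k}^{[\infty]}$ such that $$\langle P \rangle_{\pm k}^{[\infty]} \subseteq \left(c^{-1}\{i\}\right)_1.$$
   Context: $\omega$ is the set of non-negative integers, $\mathbb{N}$ the set of positive integers, and each $r<\omega$ is identified with $\{0,\dots,r-1\}$. For $k \in \mathbb{N}$, $\mathrm{FIN}_{\pm k}$ is the set of all functions $p : \omega \to \{0,\pm 1,\dots,\pm k\}$ with finite support $\operatorname{supp} p := \{n : p(n)\neq 0\}$ that attain at least one of the values $k$, $-k$ (and $\mathrm{FIN}_{\pm 0}$ consists of the zero function). Write $p<q$ if $\max \operatorname{supp} p < \min\operatorname{supp} q$. Sums and negatives are coordinatewise. The tetris operation $T : \mathrm{FIN}_{\pm k}\to \mathrm{FIN}_{\pm(k-1)}$ is $T(p)(n) = p(n)-1$ if $p(n)>0$, $0$ if $p(n)=0$, $p(n)+1$ if $p(n)<0$; $T^j$ is its $j$-th iterate ($T^0=\mathrm{id}$). A block sequence in $\mathrm{FIN}_{\pm k}$ of length $\alpha \le \omega$ is a sequence $(p_n)_{n<\alpha}$ in $\mathrm{FIN}_{\pm k}$ with $p_n<p_m$ for all $n<m<\alpha$. $\mathrm{FIN}_{\pm k}^{[m]}$ is the set of block sequences of length $m$ and $\mathrm{FIN}_{\pm k}^{[\infty]}$ the set of infinite ones. For a block sequence $P=(p_n)_{n<\alpha}$, $$\langle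 P\rangle_{\pm k} := \{\varepsilon_0 T^{j_0}(p_{n_0})+\dots+\varepsilon_m T^{j_m}(p_{n_m}) : m<\omega,\ n_0<\dots<n_m<\alpha,\ \varepsilon_i\in\{\pm1\},\ j_0,\dots,j_m<k,\ \min_i j_i=0\}.$$ $\langle P\rangle_{\pm k}^{[\infty]}$ is the set of all $Q=(q_n)_{n<\omega}\in \mathrm{FIN}_{\pm k}^{[\infty]}$ with $q_n\in\langle P\rangle_{\pm k}$ for all $n<\omega$. For $p,q\in\mathrm{FIN}_{\pm k}$, $\|p-q\| := \sup_n |p(n)-q(n)|$; for $P=(p_n)_{n<\omega},Q=(q_n)_{n<\omega}\in\mathrm{FIN}_{\pm k}^{[\infty]}$, $\|P-Q\| := \sup_n\|p_n-q_n\|$. For $\mathcal{X}\subseteq \mathrm{FIN}_{\pm k}^{[\infty]}$ and $\varepsilon>0$, $(\mathcal{X})_\varepsilon := \{P\in\mathrm{FIN}_{\pm k}^{[\infty]} : (\exists Q\in\mathcal{X})\ \|P-Q\|\le\varepsilon\}$. $\mathrm{FIN}_{\pm k}^{[\infty]}$ carries the metrizable topology generated by the basic open sets $\{(p_n)_{n<\omega}\in\mathrm{FIN}_{\pm k}^{[\infty]} : p_i=q_i \text{ for all } i<m\}$, where $m<\omega$ and $(q_0,\dots,q_{m-1})\in\mathrm{FIN}_{\pm k}^{[m]}$. The Souslin operation turns a family of sets $(X_s)_{s\in\omega^{<\omega}}$ into $\bigcup_{x\in\omega^\omega}\bigcap_{n<\omega}X_{x\restriction n}$. The Souslin measurable subsets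 of a topological space $X$ form the smallest field of subsets of $X$ that contains all open sets and is closed under the Souslin operation. A map $c:X\to r$ is Souslin measurable if $c^{-1}\{i\}$ is Souslin measurable for each $i<r$. *)

theory Defs
  imports "HOL-Analysis.Analysis"
begin

definition supp :: "(nat \<Rightarrow> int) \<Rightarrow> nat set" where
  "supp p = {n. p n \<noteq> 0}"

text \<open>For \<open>k = 0\<close> this is the singleton of the zero function.\<close>

definition FIN_pm :: "nat \<Rightarrow> (nat \<Rightarrow> int) set" where
  "FIN_pm k = {p. (\<forall>n. p n \<in> {- int k..int k}) \<and> finite (supp p) \<and>
                  (\<exists>n. p n = int k \<or> p n = - int k)}"

text \<open>Only meaningful when both supports are finite and nonempty, as is the case on
  \<open>FIN_pm k\<close> for \<open>k \<ge> 1\<close>.\<close>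

definition block_less :: "(nat \<Rightarrow> int) \<Rightarrow> (nat \<Rightarrow> int) \<Rightarrow> bool" where
  "block_less p q \<longleftrightarrow> Max (supp p) < Min (supp q)"

definition tetris :: "(nat \<Rightarrow> int) \<Rightarrow> nat \<Rightarrow> int" where
  "tetris p = (\<lambda>n. if p n > 0 then p n - 1 else if p n = 0 then 0 else p n + 1)"

text \<open>A sequence of length \<open>\<alpha> \<le> \<omega>\<close> is a function on \<open>nat\<close> that is \<open>undefined\<close> at all indices
  \<open>\<ge> \<alpha>\<close>; for \<open>\<alpha> = \<infinity>\<close> it is an arbitrary function on \<open>nat\<close>.\<close>

definition block_seqs :: "nat \<Rightarrow> enat \<Rightarrow> (nat \<Rightarrow> nat \<Rightarrow> int) set" where
  "block_seqs k \<alpha> = {p \<in> {n. enat n < \<alpha>} \<rightarrow>\<^sub>E FIN_pm k.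
                       \<forall>n m. n < m \<and> enat m < \<alpha> \<longrightarrow> block_less (p n) (p m)}"

definition span_pm :: "nat \<Rightarrow> enat \<Rightarrow> (nat \<Rightarrow> nat \<Rightarrow> int) \<Rightarrow> (nat \<Rightarrow> int) set" where
  "span_pm k \<alpha> p =
     {(\<lambda>x. \<Sum>i\<le>m. \<epsilon> i * (tetris ^^ j i) (p (n i)) x) | (m :: nat) n \<epsilon> j.
        strict_mono_on {..m} n \<and> (\<forall>i\<le>m. enat (n i) < \<alpha>) \<and>
        (\<forall>i\<le>m. \<epsilon> i \<in> {1, -1}) \<and> (\<forall>i\<le>m. j i < k) \<and> Min (j ` {..m}) = 0}"

definition block_subseqs_pm :: "nat \<Rightarrow> (nat \<Rightarrow> nat \<Rightarrow> int) \<Rightarrow> (nat \<Rightarrow> nat \<Rightarrow> int) set" where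
  "block_subseqs_pm k P = {Q \<in> block_seqs k \<infinity>. \<forall>n. Q n \<in> span_pm k \<infinity> P}"

text \<open>On \<open>FIN_pm k\<close> and \<open>block_seqs k \<infinity>\<close> the following suprema are over nonempty sets of
  reals bounded above by \<open>2 * k\<close>.\<close>

definition dist_FIN :: "(nat \<Rightarrow> int) \<Rightarrow> (nat \<Rightarrow> int) \<Rightarrow> real" where
  "dist_FIN p q = (SUP n. real_of_int \<bar>p n - q n\<bar>)"

definition dist_seq :: "(nat \<Rightarrow> nat \<Rightarrow> int) \<Rightarrow> (nat \<Rightarrow> nat \<Rightarrow> int) \<Rightarrow> real" where
  "dist_seq P Q = (SUP n. dist_FIN (P n) (Q n))"

definition enlargement ::
  "nat \<Rightarrow> real \<Rightarrow> (nat \<Rightarrow> nat \<Rightarrow> int) set \<Rightarrow> (nat \<Rightarrow> nat \<Rightarrow> int) set" where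
  "enlargement k \<epsilon> X = {P \<in> block_seqs k \<infinity>. \<exists>Q\<in>X. dist_seq P Q \<le> \<epsilon>}"

definition block_topology :: "nat \<Rightarrow> (nat \<Rightarrow> nat \<Rightarrow> int) topology" where
  "block_topology k = topology_generated_by
     {{p \<in> block_seqs k \<infinity>. \<forall>i<m. p i = q i} | (m :: nat) q. q \<in> block_seqs k (enat m)}"

lemma topspace_block_topology: "topspace (block_topology k) = block_seqs k \<infinity>"
proof -
  have "(\<lambda>_. undefined) \<in> block_seqs k (enat 0)"
    by (auto simp: block_seqs_def zero_enat_def[symmetric])
  then have "block_seqs k \<infinity> \<in>
      {{p \<in> block_seqs k \<infinity>. \<forall>i<m. p i = q i} | (m :: nat) q. q \<in> block_seqs k (enat m)}"
    by (intro CollectI exI[of _ 0] exI[of _ "\<lambda>_. undefined"]) auto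
  then show ?thesis
    unfolding block_topology_def topology_generated_by_topspace by blast
qed

text \<open>Finite sequences are lists; \<open>map x [0..<n]\<close> is the restriction of \<open>x\<close> to
  \<open>{0, \<dots>, n - 1}\<close>.\<close>

definition souslin_operation :: "(nat list \<Rightarrow> 'a set) \<Rightarrow> 'a set" where
  "souslin_operation X = (\<Union>x :: nat \<Rightarrow> nat. \<Inter>n. X (map x [0..<n]))"

definition souslin_sets :: "'a topology \<Rightarrow> 'a set set" where
  "souslin_sets X = \<Inter>{M. algebra (topspace X) M \<and> {U. openin X U} \<subseteq> M \<and>
                          (\<forall>A. range A \<subseteq> M \<longrightarrow> souslin_operation A \<in> M)}"

definition souslin_measurable_map :: "'a topology \<Rightarrow> nat \<Rightarrow> ('a \<Rightarrow> nat) \<Rightarrow> bool" where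
  "souslin_measurable_map X r c \<longleftrightarrow>
     c \<in> topspace X \<rightarrow> {..<r} \<and> (\<forall>i<r. c -` {i} \<inter> topspace X \<in> souslin_sets X)"

end

theory Submission
  imports Defs "HOL-Library.Function_Algebras"
begin

text \<open>
  The proof has an exact part and an approximate part.

  The exact part replaces the tetris operation \<open>T\<close> by \<open>S = - T\<close> and forgets all other signs.
  Since \<open>S\<close> is additive on disjoint supports and maps \<open>FIN_pm (k + 1)\<close> onto \<open>FIN_pm k\<close>
  for \<open>k \<ge> 1\<close>, Gowers' ultrafilter argument applies to \<open>S\<close> in the same way as to the tetris
  operation on nonnegative functions: there is an ultrafilter \<open>u\<close> on \<open>FIN_pm k\<close> for
  which the iterated images \<open>u, S u, S (S u), \<dots>\<close> satisfy
  \<open>S\<^sup>i u \<oplus> S\<^sup>j u = S\<^bsup>min i j\<^esup> u\<close> (\<open>gowers_layers\<close>).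
  To colour infinite sequences, consider trees in which every node has \<open>u\<close>-many
  successors, and call a set of sequences decided if below every finite stem such a
  tree has all its branches inside the set or all outside. For an arbitrary ultrafilter the
  decided sets contain the open sets, form a field and are closed under the Souslin
  operation (\<open>tree_open_decided\<close>, \<open>decided_souslin\<close>), so some \<open>u\<close>-branching tree has
  branches of a single colour. The equations for \<open>u\<close> then produce block vectors
  \<open>g\<^sub>0 < g\<^sub>1 < \<dots>\<close> such that every block sequence of sums of terms \<open>S\<^sup>j g\<^sub>i\<close>, with some
  exponent \<open>j = 0\<close> in each sum, is a branch of that tree (\<open>generic_blocks_homogeneous\<close>).

  The approximate part recovers the arbitrary signs. The key observation is that
  \<open>- p\<close> and \<open>S p = - T p\<close> differ by at most 1 at every point. With
  \<open>P\<^sub>n = g\<^bsub>2n\<^esub> + S g\<^bsub>2n+1\<^esub>\<close> we get \<open>S\<^sup>j P\<^sub>n = S\<^sup>j g\<^bsub>2n\<^esub> + S\<^bsup>j+1\<^esup> g\<^bsub>2n+1\<^esub>\<close>, and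
  \<open>- S\<^sup>j P\<^sub>n\<close> is within distance 1 of \<open>S\<^bsup>j+1\<^esup> g\<^bsub>2n\<^esub> + S\<^sup>j g\<^bsub>2n+1\<^esub>\<close>: exchanging the
  roles of the two vectors absorbs the sign and keeps the smallest exponent equal to \<open>j\<close>.
  As \<open>T\<^sup>j\<close> is \<open>S\<^sup>j\<close> up to sign, every block sequence in the span of \<open>P\<close> is within
  distance 1 of one of the monochromatic sequences (\<open>approximate_subsequence\<close>).
\<close>

section \<open>Ultrafilters and their sums\<close>

text \<open>An ultrafilter is represented by its quantifier ``for \<open>u\<close>-almost all \<open>x\<close>''. In this form
  sums and images of ultrafilters are compositions of quantifiers, and ultrafilters are points
  of a power of the discrete space \<open>bool\<close>, so that Tychonoff's theorem applies.\<close>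

definition ultra :: "(('a \<Rightarrow> bool) \<Rightarrow> bool) \<Rightarrow> bool" where
  "ultra u \<longleftrightarrow> u (\<lambda>_. True) \<and> (\<forall>P Q. u (\<lambda>x. P x \<and> Q x) \<longleftrightarrow> u P \<and> u Q) \<and>
             (\<forall>P. u (\<lambda>x. \<not> P x) \<longleftrightarrow> \<not> u P)"

lemma ultra_True: "ultra u \<Longrightarrow> u (\<lambda>_. True)"
  and ultra_conj: "ultra u \<Longrightarrow> u (\<lambda>x. P x \<and> Q x) \<longleftrightarrow> u P \<and> u Q"
  and ultra_not: "ultra u \<Longrightarrow> u (\<lambda>x. \<not> P x) \<longleftrightarrow> \<not> u P"
  by (auto simp: ultra_def)

lemma ultra_False: "ultra u \<Longrightarrow> \<not> u (\<lambda>_. False)"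
  using ultra_not[of u "\<lambda>_. True"] ultra_True[of u] by simp

lemma ultra_mono:
  assumes "ultra u" "u P" "\<And>x. P x \<Longrightarrow> Q x"
  shows "u Q"
proof -
  have "(\<lambda>x. P x \<and> Q x) = P" using assms(3) by auto
  then show ?thesis using ultra_conj[OF assms(1), of P Q] assms(2) by simp
qed

lemma ultra_ex: "ultra u \<Longrightarrow> u P \<Longrightarrow> \<exists>x. P x"
  using ultra_mono[of u P "\<lambda>_. False"] ultra_False by blast

text \<open>Only the behaviour on a set of measure one matters; this is how properties that hold for
  disjoint supports alone enter the algebra of ultrafilters.\<close>

lemma ultra_cong:
  assumes "ultra u" "u R" "\<And>x. R x \<Longrightarrow> P x \<longleftrightarrow> Q x"
  shows "u P \<longleftrightarrow> u Q"
proof -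
  have "u P \<longleftrightarrow> u (\<lambda>x. R x \<and> P x)" "u Q \<longleftrightarrow> u (\<lambda>x. R x \<and> Q x)"
    using assms(2) by (simp_all add: ultra_conj[OF assms(1)])
  moreover have "(\<lambda>x. R x \<and> P x) = (\<lambda>x. R x \<and> Q x)" using assms(3) by auto
  ultimately show ?thesis by simp
qed

lemma ultra_ball:
  assumes "ultra u" "finite I"
  shows "u (\<lambda>x. \<forall>i\<in>I. P i x) \<longleftrightarrow> (\<forall>i\<in>I. u (P i))"
  using assms(2) by induction (simp_all add: ultra_True ultra_conj[OF assms(1)] assms(1))

definition push :: "('a \<Rightarrow> 'b) \<Rightarrow> (('a \<Rightarrow> bool) \<Rightarrow> bool) \<Rightarrow> ('b \<Rightarrow> bool) \<Rightarrow> bool" where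
  "push f u = (\<lambda>P. u (\<lambda>x. P (f x)))"

definition uf_add ::
  "(('a::plus \<Rightarrow> bool) \<Rightarrow> bool) \<Rightarrow> (('a \<Rightarrow> bool) \<Rightarrow> bool) \<Rightarrow> ('a \<Rightarrow> bool) \<Rightarrow> bool"
  (infixl "\<oplus>" 65) where
  "u \<oplus> v = (\<lambda>P. u (\<lambda>x. v (\<lambda>y. P (x + y))))"

lemma ultra_push: "ultra u \<Longrightarrow> ultra (push f u)"
  by (auto simp: ultra_def push_def)

lemma ultra_uf_add: "ultra u \<Longrightarrow> ultra v \<Longrightarrow> ultra (u \<oplus> v)"
  by (simp add: ultra_def uf_add_def)

lemma uf_add_assoc: "(u \<oplus> v) \<oplus> w = u \<oplus> (v \<oplus> (w :: ('a::semigroup_add \<Rightarrow> bool) \<Rightarrow> bool))"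
  by (simp add: uf_add_def add.assoc)

section \<open>The compact space of ultrafilters\<close>

lemma compact_bool_fun: "compact (UNIV :: ('a \<Rightarrow> bool) set)"
proof -
  have "compact_space (product_topology (\<lambda>_::'a. euclidean :: bool topology) UNIV)"
    using compact_space_product_topology[of "\<lambda>_::'a. euclidean :: bool topology" UNIV]
    by (simp add: compact_space_def finite_imp_compact)
  then show ?thesis
    unfolding euclidean_product_topology by (simp add: compact_space_def)
qed

lemma continuous_coord: "continuous_on S (\<lambda>u :: 'a \<Rightarrow> bool. u x)"
  by (rule continuous_on_subset[OF continuous_on_product_coordinates]) simp

lemma open_coord_vimage:
  fixes U :: "'b::topological_space set"
  shows "open U \<Longrightarrow> open {h :: 'a \<Rightarrow> 'b. h i \<in> U}"
  using open_vimage[of U "\<lambda>h. h i"] by (simp add: vimage_def)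

text \<open>Products of Hausdorff spaces are Hausdorff. The instances for the weaker separation
  classes come first because type class arities must be monotone along the class hierarchy.\<close>

instance "fun" :: (type, t0_space) t0_space
proof
  fix f g :: "'a \<Rightarrow> 'b" assume "f \<noteq> g"
  then obtain i where i: "f i \<noteq> g i" by auto
  obtain U where "open U" "f i \<in> U \<longleftrightarrow> g i \<notin> U" using i separation_t0[of "f i" "g i"] by auto
  then show "\<exists>U. open U \<and> \<not> (f \<in> U \<longleftrightarrow> g \<in> U)"
    by (intro exI[of _ "{h. h i \<in> U}"]) (auto intro: open_coord_vimage)
qed

instance "fun" :: (type, t1_space) t1_space
proof
  fix f g :: "'a \<Rightarrow> 'b" assume "f \<noteq> g"
  then obtain i where i: "f i \<noteq> g i" by auto
  obtain U where "open U" "f i \<in> U" "g i \<notin> U" using t1_space[OF i] by auto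
  then show "\<exists>U. open U \<and> f \<in> U \<and> g \<notin> U"
    by (intro exI[of _ "{h. h i \<in> U}"]) (auto intro: open_coord_vimage)
qed

instance "fun" :: (type, t2_space) t2_space
proof
  fix f g :: "'a \<Rightarrow> 'b" assume "f \<noteq> g"
  then obtain i where i: "f i \<noteq> g i" by auto
  obtain U V where "open U" "open V" "f i \<in> U" "g i \<in> V" "U \<inter> V = {}"
    using hausdorff[OF i] by auto
  then show "\<exists>U V. open U \<and> open V \<and> f \<in> U \<and> g \<in> V \<and> U \<inter> V = {}"
    by (intro exI[of _ "{h. h i \<in> U}"] exI[of _ "{h. h i \<in> V}"])
      (auto intro: open_coord_vimage)
qed

lemma clopen_coord: "closed {u :: 'a \<Rightarrow> bool. u x}" "open {u :: 'a \<Rightarrow> bool. u x}"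
proof -
  have eq: "{u :: 'a \<Rightarrow> bool. u x} = (\<lambda>u. u x) -` {True}" by auto
  show "closed {u :: 'a \<Rightarrow> bool. u x}"
    unfolding eq by (rule closed_vimage[OF _ continuous_coord]) simp
  show "open {u :: 'a \<Rightarrow> bool. u x}"
    unfolding eq by (rule open_vimage[OF open_discrete continuous_coord])
qed

lemma closed_ultra: "closed {u :: ('a \<Rightarrow> bool) \<Rightarrow> bool. ultra u}"
proof -
  have conj: "closed {u :: ('a \<Rightarrow> bool) \<Rightarrow> bool. u R \<longleftrightarrow> u P \<and> u Q}" for P Q R
  proof -
    have eq: "{u :: ('a \<Rightarrow> bool) \<Rightarrow> bool. u R \<longleftrightarrow> u P \<and> u Q} =
       ({u. u R} \<inter> {u. u P} \<inter> {u. u Q}) \<union> (- {u. u R} \<inter> (- {u. u P} \<union> - {u. u Q}))" by auto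
    show ?thesis
      unfolding eq by (intro closed_Int closed_Un closed_Compl clopen_coord)
  qed
  have neg: "closed {u :: ('a \<Rightarrow> bool) \<Rightarrow> bool. u R \<longleftrightarrow> \<not> u P}" for P R
  proof -
    have eq: "{u :: ('a \<Rightarrow> bool) \<Rightarrow> bool. u R \<longleftrightarrow> \<not> u P} =
       ({u. u R} \<inter> - {u. u P}) \<union> (- {u. u R} \<inter> {u. u P})" by auto
    show ?thesis
      unfolding eq by (intro closed_Int closed_Un closed_Compl clopen_coord)
  qed
  show ?thesis
    unfolding ultra_def
    by (intro closed_Collect_conj closed_Collect_all conj neg clopen_coord)
qed

lemma continuous_push: "continuous_on S (push f)"
  unfolding push_def by (intro continuous_on_coordinatewise_then_product continuous_coord)

text \<open>Continuity holds in the left argument only: evaluating \<open>u \<oplus> v\<close> at a predicate queries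
  \<open>u\<close> at one predicate, which depends on \<open>v\<close>.\<close>

lemma continuous_uf_add: "continuous_on S (\<lambda>u. u \<oplus> v)"
  unfolding uf_add_def by (intro continuous_on_coordinatewise_then_product continuous_coord)

text \<open>The Ellis-Numakura lemma. A minimal compact subsemigroup \<open>M\<close> exists by Zorn's lemma; for
  \<open>e \<in> M\<close>, minimality gives first \<open>M e = M\<close> and then that the nonempty compact subsemigroup
  of all \<open>y\<close> with \<open>y e = e\<close> is all of \<open>M\<close>, so it contains \<open>e\<close>.\<close>

theorem compact_semigroup_idempotent:
  fixes S :: "'a::t2_space set"
  assumes "compact S" "S \<noteq> {}"
    and closed_f: "\<And>x y. x \<in> S \<Longrightarrow> y \<in> S \<Longrightarrow> f x y \<in> S"
    and assoc: "\<And>x y z. f (f x y) z = f x (f y z)"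
    and cont: "\<And>y. continuous_on S (\<lambda>x. f x y)"
  shows "\<exists>e\<in>S. f e e = e"
proof -
  define \<A> where "\<A> = {T. T \<subseteq> S \<and> compact T \<and> T \<noteq> {} \<and> (\<forall>x\<in>T. \<forall>y\<in>T. f x y \<in> T)}"
  have "\<exists>m\<in>\<A>. \<forall>a\<in>\<A>. m \<supseteq> a \<longrightarrow> a = m"
  proof (rule predicate_Zorn)
    show "partial_order_on \<A> (relation_of (\<lambda>x y. x \<supseteq> y) \<A>)"
      by (rule partial_order_on_relation_ofI) auto
    fix C assume C: "C \<in> Chains (relation_of (\<lambda>x y. x \<supseteq> y) \<A>)"
    then have sub: "C \<subseteq> \<A>" and lin: "\<And>X Y. X \<in> C \<Longrightarrow> Y \<in> C \<Longrightarrow> X \<subseteq> Y \<or> Y \<subseteq> X"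
      by (auto simp: Chains_def relation_of_def)
    show "\<exists>u\<in>\<A>. \<forall>a\<in>C. u \<subseteq> a"
    proof (cases "C = {}")
      case True
      then show ?thesis using assms(1,2) closed_f by (auto simp: \<A>_def intro!: bexI[of _ S])
    next
      case False
      have cl: "closed T" if "T \<in> C" for T
        using that sub by (auto simp: \<A>_def compact_imp_closed)
      have f_Inter: "f x y \<in> \<Inter>C" if "x \<in> \<Inter>C" "y \<in> \<Inter>C" for x y
        using that sub unfolding \<A>_def by blast
      have "S \<inter> \<Inter>C \<noteq> {}"
      proof (rule compact_imp_fip[OF assms(1) cl])
        fix F assume F: "finite F" "F \<subseteq> C"
        show "S \<inter> \<Inter>F \<noteq> {}"
        proof (cases "F = {}")
          case True then show ?thesis using assms(2) by simp
        next
          case False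
          have "\<Inter>F \<in> F"
          proof (rule ccontr)
            assume "\<Inter>F \<notin> F"
            have "\<exists>T\<in>F. \<forall>X\<in>F. T \<subseteq> X"
              using F(1) False F(2)
            proof (induction rule: finite_ne_induct)
              case (insert T F)
              then obtain T' where T': "T' \<in> F" "\<forall>X\<in>F. T' \<subseteq> X" by auto
              moreover have "T \<subseteq> T' \<or> T' \<subseteq> T" using insert.prems T'(1) lin by blast
              ultimately show ?case by (metis insert_iff subset_refl subset_trans)
            qed auto
            then obtain T where "T \<in> F" "\<forall>X\<in>F. T \<subseteq> X" by blast
            then have "\<Inter>F = T" by blast
            then show False using \<open>T \<in> F\<close> \<open>\<Inter>F \<notin> F\<close> by simp
          qed
          then have "\<Inter>F \<in> \<A>" using F sub by blast
          then show ?thesis by (auto simp: \<A>_def)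
        qed
      qed
      moreover have "\<Inter>C \<subseteq> S" using False sub unfolding \<A>_def by blast
      moreover have "compact (S \<inter> \<Inter>C)"
        using assms(1) cl by (intro compact_Int_closed closed_Inter) auto
      ultimately have "\<Inter>C \<in> \<A>"
        using f_Inter unfolding \<A>_def mem_Collect_eq by (metis inf.absorb2)
      then show ?thesis by blast
    qed
  qed
  then obtain M where M: "M \<in> \<A>" and min: "\<And>T. T \<in> \<A> \<Longrightarrow> T \<subseteq> M \<Longrightarrow> T = M" by blast
  then obtain e where e: "e \<in> M" by (auto simp: \<A>_def)
  have MS: "M \<subseteq> S" "compact M" and Mf: "\<And>x y. x \<in> M \<Longrightarrow> y \<in> M \<Longrightarrow> f x y \<in> M"
    using M by (auto simp: \<A>_def)
  have cM: "continuous_on M (\<lambda>x. f x e)" using cont MS(1) continuous_on_subset by blast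
  have "(\<lambda>x. f x e) ` M \<in> \<A>"
  proof -
    have "f (f x e) (f y e) \<in> (\<lambda>x. f x e) ` M" if "x \<in> M" "y \<in> M" for x y
      using Mf[OF Mf[OF that(1) e] that(2)] assoc[of "f x e" y e] by (metis imageI)
    then show ?thesis
      using MS e Mf compact_continuous_image[OF cM MS(2)] unfolding \<A>_def by blast
  qed
  then have "(\<lambda>x. f x e) ` M = M" using min Mf e by blast
  then obtain y where y: "y \<in> M" "f y e = e" using e by (metis imageE)
  let ?T = "{y\<in>M. f y e = e}"
  have "compact ?T"
  proof -
    have "closed ?T"
      using continuous_closed_preimage_constant[OF cM compact_imp_closed[OF MS(2)]] .
    then have "compact (M \<inter> ?T)" using MS(2) by (rule compact_Int_closed[rotated])
    then show ?thesis by (simp add: Int_absorb1)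
  qed
  moreover have "f x z \<in> ?T" if "x \<in> ?T" "z \<in> ?T" for x z
    using that Mf by (simp add: assoc)
  moreover have "?T \<subseteq> S" "?T \<noteq> {}" using MS y by blast+
  ultimately have "?T \<in> \<A>" unfolding \<A>_def by blast
  then have "?T = M" using min by blast
  then show ?thesis using e MS(1) by blast
qed

section \<open>Sets decided by ultrafilter-branching trees\<close>

text \<open>A tree on \<open>'a\<close> is given by the set \<open>A t\<close> of successors of each node \<open>t\<close>; \<open>branches s A\<close>
  consists of its infinite branches through the stem \<open>s\<close>. When all \<open>A t\<close> belong to a fixed
  ultrafilter, these sets are the basis of an Ellentuck-type topology, whose open sets are the
  \<open>tree_open\<close> ones. In this topology \<open>negligible_for\<close> means nowhere dense, and \<open>decided\<close>
  plays the role of the Baire property (or of being completely Ramsey).\<close>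

definition branches :: "'a list \<Rightarrow> ('a list \<Rightarrow> 'a \<Rightarrow> bool) \<Rightarrow> (nat \<Rightarrow> 'a) set" where
  "branches s A = {x. map x [0..<length s] = s \<and> (\<forall>n\<ge>length s. A (map x [0..<n]) (x n))}"

definition decided ::
  "(('a \<Rightarrow> bool) \<Rightarrow> bool) \<Rightarrow> (nat \<Rightarrow> 'a) set \<Rightarrow> bool" where
  "decided u X \<longleftrightarrow> (\<forall>s. \<exists>A. (\<forall>t. u (A t)) \<and> (branches s A \<subseteq> X \<or> branches s A \<inter> X = {}))"

definition negligible_for ::
  "(('a \<Rightarrow> bool) \<Rightarrow> bool) \<Rightarrow> (nat \<Rightarrow> 'a) set \<Rightarrow> bool" where
  "negligible_for u X \<longleftrightarrow> (\<forall>s. \<exists>A. (\<forall>t. u (A t)) \<and> branches s A \<inter> X = {})"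

definition tree_open ::
  "(('a \<Rightarrow> bool) \<Rightarrow> bool) \<Rightarrow> (nat \<Rightarrow> 'a) set \<Rightarrow> bool" where
  "tree_open u X \<longleftrightarrow> (\<forall>x\<in>X. \<exists>s A. (\<forall>t. u (A t)) \<and> x \<in> branches s A \<and> branches s A \<subseteq> X)"

text \<open>Lengthening the stem along a branch yields a smaller neighbourhood of the same branch.\<close>

lemma branches_longer:
  assumes "x \<in> branches s A" "length s \<le> n"
  shows "x \<in> branches (map x [0..<n]) A" "branches (map x [0..<n]) A \<subseteq> branches s A"
proof -
  show "x \<in> branches (map x [0..<n]) A" using assms by (auto simp: branches_def)
  show "branches (map x [0..<n]) A \<subseteq> branches s A"
  proof
    fix y assume y: "y \<in> branches (map x [0..<n]) A"
    then have yx: "\<And>i. i < n \<Longrightarrow> y i = x i" and yA: "\<And>m. m \<ge> n \<Longrightarrow> A (map y [0..<m]) (y m)"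
      by (auto simp: branches_def)
    have "map y [0..<m] = map x [0..<m]" if "m \<le> n" for m
      using that yx by auto
    then show "y \<in> branches s A"
      using assms yx yA unfolding branches_def
      by (smt (verit) linorder_not_le mem_Collect_eq order.strict_implies_order)
  qed
qed

lemma branches_mono:
  assumes "\<And>t y. A t y \<Longrightarrow> B t y" shows "branches s A \<subseteq> branches s B"
  using assms by (auto simp: branches_def)

lemma branches_nonempty:
  assumes "\<And>t. \<exists>y. A t y"
  shows "branches s A \<noteq> {}"
proof -
  define pick where "pick t = (SOME y. A t y)" for t
  have pick: "A t (pick t)" for t
    using assms[of t] unfolding pick_def by (rule someI_ex)
  define grow where "grow n = ((\<lambda>t. t @ [pick t]) ^^ n) s" for n
  have grow_Suc: "grow (Suc n) = grow n @ [pick (grow n)]" for n by (simp add: grow_def)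
  have len: "length (grow n) = length s + n" for n
    by (induction n) (simp_all add: grow_def)
  have nth: "grow (n + d) ! i = grow n ! i" if "i < length s + n" for n d i
    using that by (induction d) (simp_all add: grow_Suc nth_append len)
  define x where "x i = grow (Suc i) ! i" for i
  have xg: "x i = grow n ! i" if "i < length s + n" for i n
  proof -
    have "grow (Suc i + n) ! i = grow (Suc i) ! i" by (rule nth) simp
    moreover have "grow (n + Suc i) ! i = grow n ! i" by (rule nth) (rule that)
    ultimately show ?thesis by (simp add: x_def add.commute)
  qed
  have init: "map x [0..<length s + n] = grow n" for n
    by (rule nth_equalityI) (auto simp: len xg)
  have "map x [0..<length s] = s" using init[of 0] by (simp add: grow_def)
  moreover have "A (map x [0..<n]) (x n)" if n: "length s \<le> n" for n
  proof -
    obtain d where d: "n = length s + d" using le_Suc_ex[OF n] by blast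
    have "x n = grow (Suc d) ! n" by (rule xg) (simp add: d)
    also have "\<dots> = pick (grow d)" by (simp add: grow_Suc nth_append len d)
    finally show ?thesis using pick init[of d] d by simp
  qed
  ultimately show ?thesis by (auto simp: branches_def)
qed

context
  fixes u :: "('a \<Rightarrow> bool) \<Rightarrow> bool"
  assumes u: "ultra u"
begin

text \<open>Call a stem good if some tree over it lies inside the open set \<open>X\<close>. If \<open>u\<close>-almost all
  one-step extensions are good, their trees can be glued, so the stem is good. Hence a bad stem has
  \<open>u\<close>-almost only bad extensions, and the tree of bad extensions avoids \<open>X\<close> by openness.\<close>

lemma tree_open_decided:
  assumes "tree_open u X"
  shows "decided u X"
  unfolding decided_def
proof
  fix s
  define good where "good t \<longleftrightarrow> (\<exists>A. (\<forall>t. u (A t)) \<and> branches t A \<subseteq> X)" for t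
  have good_step: "good t" if "u (\<lambda>y. good (t @ [y]))" for t
  proof -
    define A where "A y = (SOME A. (\<forall>t. u (A t)) \<and> branches (t @ [y]) A \<subseteq> X)" for y
    have A: "(\<forall>t'. u (A y t')) \<and> branches (t @ [y]) (A y) \<subseteq> X" if "good (t @ [y])" for y
      using that unfolding good_def A_def by (rule someI_ex)
    \<comment> \<open>The glued tree: first step into a good extension, then follow that extension's tree.\<close>
    define B where "B t' = (if t' = t then (\<lambda>y. good (t @ [y]))
       else if good (t @ [t' ! length t]) then A (t' ! length t) t' else (\<lambda>_. True))" for t'
    have "\<forall>t'. u (B t')" using that A u by (auto simp: B_def ultra_True[OF u])
    moreover have "branches t B \<subseteq> X"
    proof
      fix x assume x: "x \<in> branches t B"
      let ?n = "length t"
      have t: "map x [0..<?n] = t" using x by (simp add: branches_def)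
      then have "B t (x ?n)" using x by (force simp: branches_def)
      then have g: "good (t @ [x ?n])" by (simp add: B_def)
      have "x \<in> branches (t @ [x ?n]) (A (x ?n))"
      proof -
        have "A (x ?n) (map x [0..<m]) (x m)" if "m \<ge> Suc ?n" for m
        proof -
          have "B (map x [0..<m]) (x m)" using x that by (auto simp: branches_def)
          moreover have "map x [0..<m] \<noteq> t" using that by (metis Suc_n_not_le_n length_map length_upt minus_nat.diff_0)
          moreover have "map x [0..<m] ! ?n = x ?n" using that by simp
          ultimately show ?thesis using g by (simp add: B_def)
        qed
        then show ?thesis using t by (auto simp: branches_def)
      qed
      then show "x \<in> X" using A[OF g] by blast
    qed
    ultimately show ?thesis unfolding good_def by blast
  qed
  show "\<exists>A. (\<forall>t. u (A t)) \<and> (branches s A \<subseteq> X \<or> branches s A \<inter> X = {})"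
  proof (cases "good s")
    case True then show ?thesis unfolding good_def by blast
  next
    case False
    define A where "A t = (if good t then (\<lambda>_. True) else (\<lambda>y. \<not> good (t @ [y])))" for t
    have "\<forall>t. u (A t)"
      using good_step ultra_not[OF u] ultra_True[OF u] by (auto simp: A_def)
    moreover have "branches s A \<inter> X = {}"
    proof (rule ccontr)
      assume "branches s A \<inter> X \<noteq> {}"
      then obtain x where x: "x \<in> branches s A" "x \<in> X" by blast
      have bad: "\<not> good (map x [0..<n])" if "n \<ge> length s" for n
        using that
      proof (induction n rule: dec_induct)
        case base then show ?case using x False by (simp add: branches_def)
      next
        case (step n)
        then have "A (map x [0..<n]) (x n)" using x by (simp add: branches_def)
        then show ?case using step by (simp add: A_def)
      qed
      obtain t B where B: "\<forall>t. u (B t)" "x \<in> branches t B" "branches t B \<subseteq> X"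
        using assms x(2) unfolding tree_open_def by blast
      let ?n = "max (length s) (length t)"
      have "branches (map x [0..<?n]) B \<subseteq> X" using branches_longer[OF B(2), of ?n] B(3) by auto
      then have "good (map x [0..<?n])" using B(1) unfolding good_def by blast
      then show False using bad[of ?n] by simp
    qed
    ultimately show ?thesis by blast
  qed
qed

lemma decided_Compl: "decided u X \<Longrightarrow> decided u (- X)"
  unfolding decided_def by (metis Int_Un_eq(1) disjoint_eq_subset_Compl double_complement)

text \<open>A fusion argument: the node \<open>t\<close> needs to obey only the finitely many trees that avoid
  \<open>N n\<close> for \<open>n \<le> length t\<close> above an initial segment of \<open>t\<close>. A branch in \<open>N n\<close> would from
  level \<open>n\<close> on be a branch of the tree that avoids \<open>N n\<close>. So meager sets are nowhere dense
  in this topology.\<close>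

lemma negligible_Union:
  assumes "\<And>n::nat. negligible_for u (N n)"
  shows "negligible_for u (\<Union>n. N n)"
  unfolding negligible_for_def
proof
  fix s
  have "\<forall>n t. \<exists>A. (\<forall>t'. u (A t')) \<and> branches t A \<inter> N n = {}"
    using assms unfolding negligible_for_def by blast
  then obtain A where A: "\<And>n t t'. u (A n t t')" "\<And>n t. branches t (A n t) \<inter> N n = {}" by metis
  define B where "B t y \<longleftrightarrow> (\<forall>n\<in>{..length t}. \<forall>i\<in>{..length t}. A n (take i t) t y)" for t y
  have "u (B t)" for t
    using A(1) unfolding B_def by (simp add: ultra_ball[OF u])
  moreover have "branches s B \<inter> (\<Union>n. N n) = {}"
  proof (rule ccontr)
    assume "branches s B \<inter> (\<Union>n. N n) \<noteq> {}"
    then obtain x n where x: "x \<in> branches s B" "x \<in> N n" by blast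
    let ?m = "max n (length s)"
    have "x \<in> branches (map x [0..<?m]) (A n (map x [0..<?m]))"
    proof -
      have "A n (map x [0..<?m]) (map x [0..<l]) (x l)" if l: "l \<ge> ?m" for l
      proof -
        have "B (map x [0..<l]) (x l)" using x(1) l by (simp add: branches_def)
        then have "A n (take ?m (map x [0..<l])) (map x [0..<l]) (x l)"
          using l unfolding B_def by (auto simp del: take_map)
        moreover have "take ?m (map x [0..<l]) = map x [0..<?m]" using l by (simp add: take_map)
        ultimately show ?thesis by simp
      qed
      then show ?thesis by (simp add: branches_def)
    qed
    then show False using A(2) x(2) by blast
  qed
  ultimately show "\<exists>A. (\<forall>t. u (A t)) \<and> branches s A \<inter> (\<Union>n. N n) = {}" by blast
qed

lemma negligible_subset: "negligible_for u N \<Longrightarrow> M \<subseteq> N \<Longrightarrow> negligible_for u M"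
  unfolding negligible_for_def by (meson Int_mono disjoint_iff subsetD)

lemma branches_inter: "branches s (\<lambda>t y. A t y \<and> B t y) = branches s A \<inter> branches s B"
  by (auto simp: branches_def)

lemma decided_mod_negligible:
  assumes "decided u X" "negligible_for u N" "X - N \<subseteq> Y" "Y \<subseteq> X \<union> N"
  shows "decided u Y"
  unfolding decided_def
proof
  fix s
  obtain A where A: "\<forall>t. u (A t)" "branches s A \<subseteq> X \<or> branches s A \<inter> X = {}"
    using assms(1) unfolding decided_def by blast
  obtain B where B: "\<forall>t. u (B t)" "branches s B \<inter> N = {}"
    using assms(2) unfolding negligible_for_def by blast
  have "\<forall>t. u (\<lambda>y. A t y \<and> B t y)" using A B by (simp add: ultra_conj[OF u])
  moreover have "branches s (\<lambda>t y. A t y \<and> B t y) \<subseteq> Y \<or> branches s (\<lambda>t y. A t y \<and> B t y) \<inter> Y = {}"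
    unfolding branches_inter using A(2) B(2) assms(3,4) by blast
  ultimately show "\<exists>A. (\<forall>t. u (A t)) \<and> (branches s A \<subseteq> Y \<or> branches s A \<inter> Y = {})"
    by (intro exI[of _ "\<lambda>t y. A t y \<and> B t y"]) simp
qed

text \<open>A decided set differs from its interior \<open>G\<close> by a negligible set, and unions of open sets
  are open.\<close>

lemma decided_Union:
  assumes "\<And>n::nat. decided u (X n)"
  shows "decided u (\<Union>n. X n)"
proof -
  define G where "G n = \<Union>{branches s A | s A. (\<forall>t. u (A t)) \<and> branches s A \<subseteq> X n}" for n
  have G: "G n \<subseteq> X n" for n by (auto simp: G_def)
  have "negligible_for u (X n - G n)" for n
    unfolding negligible_for_def
  proof
    fix s
    obtain A where "\<forall>t. u (A t)" "branches s A \<subseteq> X n \<or> branches s A \<inter> X n = {}"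
      using assms unfolding decided_def by blast
    then show "\<exists>A. (\<forall>t. u (A t)) \<and> branches s A \<inter> (X n - G n) = {}"
      by (intro exI[of _ A]) (auto simp: G_def)
  qed
  then have N: "negligible_for u (\<Union>n. X n - G n)" by (rule negligible_Union)
  have "tree_open u (\<Union>n. G n)" unfolding tree_open_def
  proof
    fix x assume "x \<in> (\<Union>n. G n)"
    then obtain n s A where A: "\<forall>t. u (A t)" "branches s A \<subseteq> X n" "x \<in> branches s A"
      by (auto simp: G_def)
    then have "branches s A \<subseteq> (\<Union>n. G n)" by (auto simp: G_def)
    then show "\<exists>s A. (\<forall>t. u (A t)) \<and> x \<in> branches s A \<and> branches s A \<subseteq> (\<Union>n. G n)" using A by blast
  qed
  then have "decided u (\<Union>n. G n)" by (rule tree_open_decided)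
  then show ?thesis
    by (rule decided_mod_negligible[OF _ N]) (use G in blast)+
qed

lemma decided_UNIV: "decided u UNIV"
  unfolding decided_def using ultra_True[OF u] by (metis subset_UNIV)

lemma decided_Un: assumes "decided u X" "decided u Y" shows "decided u (X \<union> Y)"
proof -
  have "X \<union> Y = (\<Union>n::nat. if n = 0 then X else Y)" by (auto split: if_splits)
  moreover have "decided u (\<Union>n::nat. if n = 0 then X else Y)"
    by (rule decided_Union) (use assms in auto)
  ultimately show ?thesis by simp
qed

lemma decided_Int: assumes "decided u X" "decided u Y" shows "decided u (X \<inter> Y)"
  using decided_Compl[OF decided_Un[OF assms[THEN decided_Compl]]] by simp

lemma decided_Diff: assumes "decided u X" "decided u Y" shows "decided u (X - Y)"
  using decided_Int[OF assms(1) decided_Compl[OF assms(2)]] by (simp add: Diff_eq)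

lemma decided_INT:
  assumes "\<And>n::nat. decided u (X n)" shows "decided u (\<Inter>n. X n)"
  using decided_Compl[OF decided_Union[of "\<lambda>n. - X n", OF decided_Compl[OF assms]]] by simp

text \<open>The closure of \<open>Y\<close>. It serves as a measurable hull: every set is contained in a decided
  set that is smallest up to negligible sets.\<close>

definition tree_hull :: "(nat \<Rightarrow> 'a) set \<Rightarrow> (nat \<Rightarrow> 'a) set" where
  "tree_hull Y = - \<Union>{branches s A | s A. (\<forall>t. u (A t)) \<and> branches s A \<inter> Y = {}}"

lemma hull_superset: "Y \<subseteq> tree_hull Y" by (auto simp: tree_hull_def)

lemma decided_hull: "decided u (tree_hull Y)"
proof -
  have "tree_open u (\<Union>{branches s A | s A. (\<forall>t. u (A t)) \<and> branches s A \<inter> Y = {}})"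
    unfolding tree_open_def by blast
  then show ?thesis unfolding tree_hull_def by (intro decided_Compl tree_open_decided)
qed

lemma hull_minimal:
  assumes "decided u Z" "Y \<subseteq> Z"
  shows "negligible_for u (tree_hull Y - Z)"
  unfolding negligible_for_def
proof
  fix s
  obtain A where A: "\<forall>t. u (A t)" "branches s A \<subseteq> tree_hull Y - Z \<or> branches s A \<inter> (tree_hull Y - Z) = {}"
    using decided_Diff[OF decided_hull assms(1)] unfolding decided_def by blast
  have "\<not> branches s A \<subseteq> tree_hull Y - Z"
  proof
    assume sub: "branches s A \<subseteq> tree_hull Y - Z"
    then have "branches s A \<inter> Y = {}" using assms(2) by blast
    then have "branches s A \<inter> tree_hull Y = {}" using A(1) unfolding tree_hull_def by blast
    then show False using sub branches_nonempty[of A s] ultra_ex[OF u] A(1) by blast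
  qed
  then show "\<exists>A. (\<forall>t. u (A t)) \<and> branches s A \<inter> (tree_hull Y - Z) = {}" using A by blast
qed

text \<open>The Szpilrajn-Marczewski argument: a notion of measurability with hulls and a \<open>\<sigma>\<close>-ideal is
  closed under the Souslin operation. Let \<open>Y s\<close> be the part of the result contributed by the
  sequences extending \<open>s\<close>, and \<open>Z s\<close> a decided hull of it inside all \<open>X t\<close> with \<open>t\<close> an
  initial segment of \<open>s\<close>. As \<open>Y s\<close> is the union of the \<open>Y (s @ [n])\<close>, the set \<open>Z s\<close> is covered
  by the \<open>Z (s @ [n])\<close> up to a negligible set. Outside these countably many negligible sets, a
  point of \<open>Z []\<close> can be followed along some sequence, so it belongs to the result.\<close>

lemma decided_souslin:
  assumes X: "\<And>s. decided u (X s)"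
  shows "decided u (souslin_operation X)"
proof -
  define D where "D s = (\<Inter>n. X (take n s))" for s
  define Y where "Y s = (\<Union>x\<in>{x. map x [0..<length s] = s}. \<Inter>n. X (map x [0..<n]))" for s
  define Z where "Z s = tree_hull (Y s) \<inter> D s" for s
  define N where "N s = Z s - (\<Union>n. Z (s @ [n]))" for s
  have YD: "Y s \<subseteq> D s" for s
  proof
    fix y assume "y \<in> Y s"
    then obtain x where x: "map x [0..<length s] = s" "\<And>n. y \<in> X (map x [0..<n])"
      by (auto simp: Y_def)
    have "take n s = map x [0..<min n (length s)]" for n
      by (subst (1) x(1)[symmetric]) (simp add: take_map min_def)
    then show "y \<in> D s" using x(2) by (auto simp: D_def)
  qed
  have YZ: "Y s \<subseteq> Z s" for s using YD hull_superset by (auto simp: Z_def)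
  have Yext: "Y s \<subseteq> (\<Union>n. Y (s @ [n]))" for s
  proof
    fix y assume "y \<in> Y s"
    then obtain x where x: "map x [0..<length s] = s" "\<And>n. y \<in> X (map x [0..<n])"
      by (auto simp: Y_def)
    then have "y \<in> Y (s @ [x (length s)])" by (auto simp: Y_def)
    then show "y \<in> (\<Union>n. Y (s @ [n]))" by blast
  qed
  have Zd: "decided u (Z s)" for s
    unfolding Z_def D_def by (intro decided_Int decided_hull decided_INT X)
  have Nn: "negligible_for u (N s)" for s
  proof (rule negligible_subset)
    show "negligible_for u (tree_hull (Y s) - (\<Union>n. Z (s @ [n])))"
      by (rule hull_minimal[OF decided_Union[OF Zd]]) (use Yext YZ in blast)
    show "N s \<subseteq> tree_hull (Y s) - (\<Union>n. Z (s @ [n]))" by (auto simp: N_def Z_def)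
  qed
  have "negligible_for u (\<Union>n. N (from_nat n))" by (intro negligible_Union Nn)
  moreover have "(\<Union>n. N (from_nat n)) = (\<Union>s. N s)" by (metis UN_extend_simps(10) surj_from_nat)
  ultimately have neg: "negligible_for u (\<Union>s. N s)" by simp
  have Y0: "Y [] = souslin_operation X" by (simp add: Y_def souslin_operation_def)
  have "Z [] - (\<Union>s. N s) \<subseteq> souslin_operation X"
  proof
    fix y assume y: "y \<in> Z [] - (\<Union>s. N s)"
    have step: "\<exists>n. y \<in> Z (s @ [n])" if "y \<in> Z s" for s
      using y that by (auto simp: N_def)
    define nx where "nx s = (SOME n. y \<in> Z (s @ [n]))" for s
    have nx: "y \<in> Z (s @ [nx s])" if "y \<in> Z s" for s
      using step[OF that] unfolding nx_def by (rule someI_ex)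
    have "branches [] (\<lambda>s n. n = nx s) \<noteq> {}" by (rule branches_nonempty) simp
    then obtain x where x: "\<And>n. x n = nx (map x [0..<n])" by (auto simp: branches_def)
    have xZ: "y \<in> Z (map x [0..<n])" for n
    proof (induction n)
      case 0 then show ?case using y by simp
    next
      case (Suc n)
      then show ?case using nx[OF Suc] x[of n] by simp
    qed
    have "y \<in> X (map x [0..<n])" for n
    proof -
      have "y \<in> D (map x [0..<n])" using xZ[of n] by (simp add: Z_def)
      then have "y \<in> X (take n (map x [0..<n]))" unfolding D_def by blast
      then show ?thesis by simp
    qed
    then show "y \<in> souslin_operation X" by (auto simp: souslin_operation_def)
  qed
  moreover have "souslin_operation X \<subseteq> Z []" using YZ[of "[]"] Y0 by simp
  ultimately show ?thesis
    by (intro decided_mod_negligible[OF Zd[of "[]"] neg]) auto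
qed

end

section \<open>The negated tetris operation\<close>

text \<open>The sign makes \<open>neg_tetris p\<close> a pointwise approximation of \<open>- p\<close> with error at most 1,
  without changing the algebra that the ultrafilter argument uses.\<close>

definition neg_tetris :: "(nat \<Rightarrow> int) \<Rightarrow> nat \<Rightarrow> int" where
  "neg_tetris p = (\<lambda>n. - tetris p n)"

text \<open>The right inverse of \<open>neg_tetris\<close> with the same support as its argument.\<close>

definition neg_lift :: "(nat \<Rightarrow> int) \<Rightarrow> nat \<Rightarrow> int" where
  "neg_lift p = (\<lambda>n. if p n > 0 then -1 - p n else if p n = 0 then 0 else 1 - p n)"

lemma neg_tetris_apply:
  "neg_tetris p n = (if p n > 0 then 1 - p n else if p n = 0 then 0 else -1 - p n)"
  by (simp add: neg_tetris_def tetris_def)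

lemma neg_tetris_lift: "neg_tetris (neg_lift p) = p"
  by (auto simp: neg_tetris_apply neg_lift_def fun_eq_iff)

lemma neg_tetris_add:
  assumes "\<And>n. p n = 0 \<or> q n = 0"
  shows "neg_tetris (p + q) = neg_tetris p + neg_tetris q"
proof
  fix n show "neg_tetris (p + q) n = (neg_tetris p + neg_tetris q) n"
    using assms[of n] by (auto simp: neg_tetris_apply)
qed

lemma FIN_pm_iff:
  "p \<in> FIN_pm k \<longleftrightarrow> (\<forall>n. \<bar>p n\<bar> \<le> int k) \<and> finite (supp p) \<and> (\<exists>n. \<bar>p n\<bar> = int k)"
proof -
  have "p n \<in> {- int k..int k} \<longleftrightarrow> \<bar>p n\<bar> \<le> int k" for n by auto
  moreover have "p n = int k \<or> p n = - int k \<longleftrightarrow> \<bar>p n\<bar> = int k" for n by auto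
  ultimately show ?thesis unfolding FIN_pm_def by simp
qed

lemma FIN_pm_0: "FIN_pm 0 = {0}"
  by (auto simp: FIN_pm_iff supp_def fun_eq_iff)

lemma finite_supp_FIN: "p \<in> FIN_pm k \<Longrightarrow> finite (supp p)"
  by (simp add: FIN_pm_iff)

lemma abs_neg_tetris: "\<bar>neg_tetris p n\<bar> = (if p n = 0 then 0 else \<bar>p n\<bar> - 1)"
  by (auto simp: neg_tetris_apply)

lemma supp_neg_tetris: "supp (neg_tetris p) \<subseteq> supp p"
  by (auto simp: supp_def neg_tetris_apply)

lemma neg_tetris_FIN:
  assumes "p \<in> FIN_pm (Suc j)" shows "neg_tetris p \<in> FIN_pm j"
proof -
  obtain n where "\<bar>p n\<bar> = int (Suc j)" using assms by (auto simp: FIN_pm_iff)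
  then have "\<bar>neg_tetris p n\<bar> = int j" by (auto simp: abs_neg_tetris)
  moreover have "\<bar>neg_tetris p n\<bar> \<le> int j" for n
  proof -
    have "\<bar>p n\<bar> \<le> int (Suc j)" using assms by (simp add: FIN_pm_iff)
    then show ?thesis by (simp add: abs_neg_tetris)
  qed
  moreover have "finite (supp (neg_tetris p))"
    using assms supp_neg_tetris finite_subset by (metis finite_supp_FIN)
  ultimately show ?thesis by (auto simp: FIN_pm_iff)
qed

text \<open>The zero function has no lift of norm 1 with the same support, so the statement begins at
  \<open>FIN_pm 1\<close>.\<close>

lemma neg_lift_FIN:
  assumes "p \<in> FIN_pm (Suc j)" shows "neg_lift p \<in> FIN_pm (Suc (Suc j))"
proof -
  have abs: "\<bar>neg_lift p n\<bar> = (if p n = 0 then 0 else \<bar>p n\<bar> + 1)" for n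
    by (simp add: neg_lift_def)
  obtain n where "\<bar>p n\<bar> = int (Suc j)" using assms by (auto simp: FIN_pm_iff)
  then have "\<bar>neg_lift p n\<bar> = int (Suc (Suc j))" by (auto simp: abs)
  moreover have "\<bar>neg_lift p n\<bar> \<le> int (Suc (Suc j))" for n
  proof -
    have "\<bar>p n\<bar> \<le> int (Suc j)" using assms by (simp add: FIN_pm_iff)
    then show ?thesis by (simp add: abs)
  qed
  moreover have "supp (neg_lift p) = supp p" by (auto simp: supp_def neg_lift_def)
  ultimately show ?thesis using assms by (auto simp: FIN_pm_iff)
qed

lemma FIN_pm_add:
  assumes "p \<in> FIN_pm i" "q \<in> FIN_pm j" "\<And>n. p n = 0 \<or> q n = 0"
  shows "p + q \<in> FIN_pm (max i j)"
proof -
  obtain m where m: "\<bar>p m\<bar> = int i" using assms by (auto simp: FIN_pm_iff)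
  obtain n where n: "\<bar>q n\<bar> = int j" using assms by (auto simp: FIN_pm_iff)
  have bound: "\<bar>(p + q) x\<bar> \<le> int (max i j)" for x
  proof -
    have "\<bar>p x\<bar> \<le> int i" "\<bar>q x\<bar> \<le> int j" using assms by (simp_all add: FIN_pm_iff)
    then show ?thesis using assms(3)[of x] by auto
  qed
  moreover have "\<exists>x. \<bar>(p + q) x\<bar> = int (max i j)"
  proof (cases "i \<le> j")
    case True
    then have "\<bar>(p + q) n\<bar> = int (max i j)"
      using n assms(3)[of n] bound[of n] by (cases "q n = 0") (auto)
    then show ?thesis by blast
  next
    case False
    then have "\<bar>(p + q) m\<bar> = int (max i j)"
      using m assms(3)[of m] bound[of m] by (cases "p m = 0") (auto)
    then show ?thesis by blast
  qed
  moreover have "supp (p + q) \<subseteq> supp p \<union> supp q" by (auto simp: supp_def)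
  then have "finite (supp (p + q))"
    using assms(1,2) by (meson finite_UnI finite_subset finite_supp_FIN)
  ultimately show ?thesis by (simp add: FIN_pm_iff)
qed

section \<open>Gowers' ultrafilter\<close>

text \<open>The last condition makes almost every \<open>y\<close> start beyond any prescribed position. So sums of
  such ultrafilters involve only sums of functions with disjoint supports, and there the pointwise
  sum of functions stays in the right layer and commutes with \<open>neg_tetris\<close>.\<close>

definition fin_ultra :: "nat \<Rightarrow> (((nat \<Rightarrow> int) \<Rightarrow> bool) \<Rightarrow> bool) set" where
  "fin_ultra k = {u. ultra u \<and> u (\<lambda>p. p \<in> FIN_pm k) \<and> (\<forall>n. u (\<lambda>p. \<forall>i<n. p i = 0))}"

lemma fin_ultraD:
  assumes "u \<in> fin_ultra k"
  shows "ultra u" "u (\<lambda>p. p \<in> FIN_pm k)" "u (\<lambda>p. \<forall>i<n. p i = 0)"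
  using assms by (auto simp: fin_ultra_def)

lemma fin_ultra_disjoint:
  assumes "v \<in> fin_ultra j" "finite (supp x)"
  shows "v (\<lambda>y. y \<in> FIN_pm j \<and> (\<forall>n. x n = 0 \<or> y n = 0))"
proof -
  obtain N where N: "\<forall>n\<in>supp x. n < N" using assms(2) finite_nat_set_iff_bounded by blast
  have "v (\<lambda>y. y \<in> FIN_pm j \<and> (\<forall>i<N. y i = 0))"
    using fin_ultraD[OF assms(1)] by (simp add: ultra_conj[OF fin_ultraD(1)[OF assms(1)]])
  then show ?thesis
    by (rule ultra_mono[OF fin_ultraD(1)[OF assms(1)]]) (use N in \<open>auto simp: supp_def\<close>)
qed

lemma fin_ultra_add:
  assumes u: "u \<in> fin_ultra i" and v: "v \<in> fin_ultra j"
  shows "u \<oplus> v \<in> fin_ultra (max i j)"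
proof -
  note U = fin_ultraD[OF u] and V = fin_ultraD[OF v]
  have "(u \<oplus> v) (\<lambda>p. p \<in> FIN_pm (max i j))" unfolding uf_add_def
  proof (rule ultra_mono[OF U(1), OF U(2)])
    fix x assume x: "x \<in> FIN_pm i"
    show "v (\<lambda>y. x + y \<in> FIN_pm (max i j))"
      by (rule ultra_mono[OF V(1), OF fin_ultra_disjoint[OF v finite_supp_FIN[OF x]]])
         (use FIN_pm_add[OF x] in blast)
  qed
  moreover have "(u \<oplus> v) (\<lambda>p. \<forall>i<n. p i = 0)" for n unfolding uf_add_def
  proof (rule ultra_mono[OF U(1), OF U(3)[of n]])
    fix x :: "nat \<Rightarrow> int" assume x: "\<forall>i<n. x i = 0"
    show "v (\<lambda>y. \<forall>i<n. (x + y) i = 0)"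
      by (rule ultra_mono[OF V(1), OF V(3)[of n]]) (use x in simp)
  qed
  ultimately show ?thesis using ultra_uf_add[OF U(1) V(1)] by (simp add: fin_ultra_def)
qed

lemma push_neg_tetris_add:
  assumes u: "u \<in> fin_ultra i" and v: "v \<in> fin_ultra j"
  shows "push neg_tetris (u \<oplus> v) = push neg_tetris u \<oplus> push neg_tetris v"
proof
  fix P
  have "v (\<lambda>y. P (neg_tetris (x + y))) \<longleftrightarrow> v (\<lambda>y. P (neg_tetris x + neg_tetris y))"
    if x: "x \<in> FIN_pm i" for x
    by (rule ultra_cong[OF fin_ultraD(1)[OF v], OF fin_ultra_disjoint[OF v finite_supp_FIN[OF x]]])
       (simp add: neg_tetris_add)
  then show "push neg_tetris (u \<oplus> v) P \<longleftrightarrow> (push neg_tetris u \<oplus> push neg_tetris v) P"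
    unfolding push_def uf_add_def by (rule ultra_cong[OF fin_ultraD(1)[OF u], OF fin_ultraD(2)[OF u]])
qed

lemma push_neg_tetris_fin_ultra:
  assumes u: "u \<in> fin_ultra (Suc j)"
  shows "push neg_tetris u \<in> fin_ultra j"
proof -
  note U = fin_ultraD[OF u]
  have "push neg_tetris u (\<lambda>p. p \<in> FIN_pm j)" unfolding push_def
    by (rule ultra_mono[OF U(1), OF U(2)]) (rule neg_tetris_FIN)
  moreover have "push neg_tetris u (\<lambda>p. \<forall>i<n. p i = 0)" for n unfolding push_def
    by (rule ultra_mono[OF U(1), OF U(3)[of n]]) (simp add: neg_tetris_apply)
  ultimately show ?thesis using ultra_push[OF U(1)] by (simp add: fin_ultra_def)
qed

text \<open>The only ultrafilter of the bottom layer is the principal one at the zero function.\<close>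

lemma fin_ultra_0: 
  assumes "u \<in> fin_ultra 0" shows "u P \<longleftrightarrow> P 0"
proof -
  have "u P \<longleftrightarrow> u (\<lambda>_. P 0)"
    by (rule ultra_cong[OF fin_ultraD(1)[OF assms], OF fin_ultraD(2)[OF assms]]) (simp add: FIN_pm_0)
  also have "\<dots> \<longleftrightarrow> P 0"
    using ultra_True[OF fin_ultraD(1)[OF assms]] ultra_False[OF fin_ultraD(1)[OF assms]]
    by (cases "P 0") simp_all
  finally show ?thesis .
qed

lemma compact_fin_ultra: "compact (fin_ultra k)"
proof -
  have "closed (fin_ultra k)" unfolding fin_ultra_def
    by (intro closed_Collect_conj closed_Collect_all closed_ultra clopen_coord)
  then have "compact (UNIV \<inter> fin_ultra k)"
    by (intro compact_Int_closed compact_bool_fun)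
  then show ?thesis by simp
qed

lemma fin_ultra_1_nonempty: "fin_ultra 1 \<noteq> {}"
proof -
  let ?C = "\<lambda>n. {u. ultra u \<and> u (\<lambda>p. p \<in> FIN_pm 1) \<and> u (\<lambda>p. \<forall>i<n. p i = 0)}"
  have "UNIV \<inter> (\<Inter>n\<in>UNIV. ?C n) \<noteq> {}"
  proof (rule compact_imp_fip_image[OF compact_bool_fun])
    show "closed (?C n)" for n
      by (intro closed_Collect_conj closed_ultra clopen_coord)
    fix I :: "nat set" assume "finite I"
    then obtain N where N: "\<forall>n\<in>I. n < N" using finite_nat_set_iff_bounded by blast
    define e :: "nat \<Rightarrow> int" where "e = (\<lambda>i. if i = N then 1 else 0)"
    have "supp e = {N}" by (auto simp: supp_def e_def)
    then have "e \<in> FIN_pm 1" by (auto simp: FIN_pm_iff e_def)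
    moreover have "\<forall>i<n. e i = 0" if "n \<in> I" for n using N that by (auto simp: e_def)
    ultimately have "(\<lambda>P. P e) \<in> (\<Inter>n\<in>I. ?C n)" by (simp add: ultra_def)
    then show "UNIV \<inter> (\<Inter>n\<in>I. ?C n) \<noteq> {}" by blast
  qed
  then show ?thesis by (auto simp: fin_ultra_def)
qed

text \<open>Induction over the layers, with \<open>T\<close> denoting the image under \<open>neg_tetris\<close>. Given \<open>u\<close> for one
  layer, the ultrafilters \<open>v\<close> of the next layer with \<open>T v = u\<close> form a nonempty compact set \<open>K\<close>,
  and the equations for \<open>u\<close> make \<open>K\<close> and \<open>K \<oplus> u\<close> semigroups. An idempotent \<open>w\<close> of
  \<open>K \<oplus> u\<close> absorbs \<open>u\<close> on the right, and \<open>u \<oplus> w\<close> absorbs it on both sides while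
  remaining idempotent.\<close>

theorem gowers_ultrafilter:
  "\<exists>u\<in>fin_ultra (Suc j). u \<oplus> u = u \<and> u \<oplus> push neg_tetris u = u \<and> push neg_tetris u \<oplus> u = u"
proof (induction j)
  case 0
  have "\<exists>u\<in>fin_ultra 1. u \<oplus> u = u"
  proof (rule compact_semigroup_idempotent[where f = "(\<oplus>)", OF compact_fin_ultra fin_ultra_1_nonempty])
    show "u \<oplus> v \<in> fin_ultra 1" if "u \<in> fin_ultra 1" "v \<in> fin_ultra 1" for u v
      using fin_ultra_add[OF that] by simp
  qed (rule uf_add_assoc continuous_uf_add)+
  then obtain u where u: "u \<in> fin_ultra 1" "u \<oplus> u = u" by blast
  have "push neg_tetris u P \<longleftrightarrow> P 0" for P
    by (rule fin_ultra_0[OF push_neg_tetris_fin_ultra]) (use u in simp)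
  then have "u \<oplus> push neg_tetris u = u" "push neg_tetris u \<oplus> u = u"
    unfolding uf_add_def by auto
  then show ?case using u by auto
next
  case (Suc j)
  let ?T = "push neg_tetris"
  obtain u where u: "u \<in> fin_ultra (Suc j)" "u \<oplus> u = u" "u \<oplus> ?T u = u" "?T u \<oplus> u = u"
    using Suc.IH by blast
  define K where "K = {v \<in> fin_ultra (Suc (Suc j)). ?T v = u}"
  have K_nonempty: "K \<noteq> {}"
  proof -
    note U = fin_ultraD[OF u(1)]
    have "push neg_lift u (\<lambda>p. p \<in> FIN_pm (Suc (Suc j)))" unfolding push_def
      by (rule ultra_mono[OF U(1), OF U(2)]) (rule neg_lift_FIN)
    moreover have "push neg_lift u (\<lambda>p. \<forall>i<n. p i = 0)" for n unfolding push_def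
      by (rule ultra_mono[OF U(1), OF U(3)[of n]]) (simp add: neg_lift_def)
    ultimately have "push neg_lift u \<in> fin_ultra (Suc (Suc j))"
      using ultra_push[OF U(1)] by (simp add: fin_ultra_def)
    moreover have "?T (push neg_lift u) = u" by (simp add: push_def neg_tetris_lift)
    ultimately show ?thesis by (auto simp: K_def)
  qed
  have "closed K"
    unfolding K_def
    by (rule continuous_closed_preimage_constant[OF continuous_push compact_imp_closed])
       (rule compact_fin_ultra)
  then have "compact (fin_ultra (Suc (Suc j)) \<inter> K)"
    by (rule compact_Int_closed[OF compact_fin_ultra])
  then have K_compact: "compact K" by (simp add: K_def Int_absorb1)
  let ?L = "(\<lambda>v. v \<oplus> u) ` K"
  have L_K: "v \<oplus> u \<in> K" if "v \<in> K" for v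
    using that fin_ultra_add[of v "Suc (Suc j)" u "Suc j"] u push_neg_tetris_add[of v _ u]
    by (auto simp: K_def)
  have K_add: "v \<oplus> w \<in> K" if "v \<in> K" "w \<in> K" for v w
    using that fin_ultra_add[of v "Suc (Suc j)" w "Suc (Suc j)"] u push_neg_tetris_add[of v _ w]
    by (auto simp: K_def)
  have "\<exists>w\<in>?L. w \<oplus> w = w"
  proof (rule compact_semigroup_idempotent[where f = "(\<oplus>)"])
    show "compact ?L" by (rule compact_continuous_image[OF continuous_uf_add K_compact])
    show "?L \<noteq> {}" using K_nonempty by simp
    fix x y assume "x \<in> ?L" "y \<in> ?L"
    then obtain v w where vw: "v \<in> K" "x = v \<oplus> u" "w \<in> K" "y = w \<oplus> u" by blast
    have "x \<oplus> y = (v \<oplus> u \<oplus> w) \<oplus> u" by (simp add: vw uf_add_assoc)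
    moreover have "v \<oplus> u \<oplus> w \<in> K" using K_add L_K vw by blast
    ultimately show "x \<oplus> y \<in> ?L" by blast
  qed (rule uf_add_assoc continuous_uf_add)+
  then obtain v where v: "v \<in> K" "(v \<oplus> u) \<oplus> (v \<oplus> u) = v \<oplus> u" by blast
  define w where "w = v \<oplus> u"
  have w: "w \<in> fin_ultra (Suc (Suc j))" "?T w = u" "w \<oplus> w = w" "w \<oplus> u = w"
    using L_K[OF v(1)] v(2) u(2) by (auto simp: w_def K_def uf_add_assoc)
  let ?x = "u \<oplus> w"
  have "?T ?x = u" using push_neg_tetris_add[OF u(1) w(1)] w(2) u(4) by simp
  moreover have "?x \<oplus> ?x = ?x" by (metis uf_add_assoc w(3,4))
  moreover have "?x \<oplus> u = ?x" by (simp add: uf_add_assoc w(4))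
  moreover have "u \<oplus> ?x = ?x" by (metis uf_add_assoc u(2))
  moreover have "?x \<in> fin_ultra (Suc (Suc j))" using fin_ultra_add[OF u(1) w(1)] by simp
  ultimately show ?case by metis
qed

lemma iterated_push:
  fixes f :: "'a \<Rightarrow> 'a"
  shows "(push f ^^ i) u = push (f ^^ i) u"
proof (induction i)
  case 0 then show ?case by (simp add: push_def)
next
  case (Suc i) then show ?case by (simp add: push_def)
qed

text \<open>The absorption laws between neighbouring layers are pushed down by \<open>neg_tetris\<close> and then
  composed by associativity.\<close>

theorem gowers_layers:
  assumes "k \<ge> 1"
  obtains u where "\<And>i. i \<le> k \<Longrightarrow> (push neg_tetris ^^ i) u \<in> fin_ultra (k - i)"
    and "\<And>i j. i \<le> k \<Longrightarrow> j \<le> k \<Longrightarrow>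
           (push neg_tetris ^^ i) u \<oplus> (push neg_tetris ^^ j) u = (push neg_tetris ^^ min i j) u"
proof -
  obtain u where u: "u \<in> fin_ultra k" "u \<oplus> u = u"
    "u \<oplus> push neg_tetris u = u" "push neg_tetris u \<oplus> u = u"
    using gowers_ultrafilter[of "k - 1"] assms by auto
  define V where "V i = (push neg_tetris ^^ i) u" for i
  have V_Suc: "V (Suc i) = push neg_tetris (V i)" for i by (simp add: V_def)
  have V_in: "V i \<in> fin_ultra (k - i)" if "i \<le> k" for i
    using that
  proof (induction i)
    case 0 then show ?case using u by (simp add: V_def)
  next
    case (Suc i)
    then show ?case
      using push_neg_tetris_fin_ultra[of "V i" "k - Suc i"] by (simp add: V_Suc Suc_diff_Suc)
  qed
  have V_hom: "push neg_tetris (V i \<oplus> V j) = V (Suc i) \<oplus> V (Suc j)" if "i \<le> k" "j \<le> k" for i j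
    using push_neg_tetris_add[OF V_in V_in] that by (simp add: V_Suc)
  have idem: "V i \<oplus> V i = V i" if "i \<le> k" for i
    using that by (induction i) (use u V_hom V_Suc in \<open>simp_all add: V_def\<close>, metis V_Suc V_def V_hom Suc_leD)
  have next_layer: "V i \<oplus> V (Suc i) = V i \<and> V (Suc i) \<oplus> V i = V i" if "Suc i \<le> k" for i
    using that
  proof (induction i)
    case 0 then show ?case using u by (simp add: V_def)
  next
    case (Suc i)
    then show ?case using V_hom[of i "Suc i"] V_hom[of "Suc i" i] by (metis Suc_leD V_Suc)
  qed
  have later: "V i \<oplus> V (i + d) = V i \<and> V (i + d) \<oplus> V i = V i" if "i + d \<le> k" for i d
    using that
  proof (induction d)
    case 0 then show ?case using idem by simp
  next
    case (Suc d)
    then have IH: "V i \<oplus> V (i + d) = V i" "V (i + d) \<oplus> V i = V i"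
      and nl: "V (i + d) \<oplus> V (i + Suc d) = V (i + d)" "V (i + Suc d) \<oplus> V (i + d) = V (i + d)"
      using next_layer[of "i + d"] by auto
    show ?case by (metis IH nl uf_add_assoc)
  qed
  have "V i \<oplus> V j = V (min i j)" if "i \<le> k" "j \<le> k" for i j
  proof (cases "i \<le> j")
    case True
    then show ?thesis using later[of i "j - i"] that by (simp add: min_def)
  next
    case False
    then show ?thesis using later[of j "i - j"] that by (simp add: min_def)
  qed
  then show ?thesis using that[of u] V_in by (simp add: V_def)
qed

section \<open>Block sequences that stay inside a tree\<close>

text \<open>The block vectors are chosen one after the other. What can have been built from those
  already chosen is recorded in states \<open>(s, y, b)\<close>: the list \<open>s\<close> of completed vectors, the partial
  sum \<open>y\<close> of the vector under construction, and the flag \<open>b\<close> that some summand of \<open>y\<close> has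
  exponent 0. A state is promising if almost every further summand that would make \<open>y\<close> a legal
  vector leads into the tree. Once \<open>b\<close> holds, this concerns every exponent \<open>i \<le> k\<close>, and
  \<open>i = k\<close>, where the summand vanishes, expresses that \<open>y\<close> itself already lies in \<open>A s\<close>.\<close>

definition promising ::
  "nat \<Rightarrow> (((nat \<Rightarrow> int) \<Rightarrow> bool) \<Rightarrow> bool) \<Rightarrow> ((nat \<Rightarrow> int) list \<Rightarrow> (nat \<Rightarrow> int) \<Rightarrow> bool) \<Rightarrow>
    (nat \<Rightarrow> int) list \<times> (nat \<Rightarrow> int) \<times> bool \<Rightarrow> bool" where
  "promising k u A = (\<lambda>(s, y, b). u (\<lambda>z. A s (y + z)) \<and>
     (b \<longrightarrow> (\<forall>i\<in>{..k}. (push neg_tetris ^^ i) u (\<lambda>z. A s (y + z)))))"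

definition extensions ::
  "nat \<Rightarrow> (nat \<Rightarrow> int) \<Rightarrow> ((nat \<Rightarrow> int) list \<times> (nat \<Rightarrow> int) \<times> bool) set \<Rightarrow>
    ((nat \<Rightarrow> int) list \<times> (nat \<Rightarrow> int) \<times> bool) set" where
  "extensions k g R =
     R \<union> {(s, y + (neg_tetris ^^ j) g, b \<or> j = 0) | s y b j. (s, y, b) \<in> R \<and> j \<le> k}"

lemma extensionsI:
  "(s, y, b) \<in> R \<Longrightarrow> j \<le> k \<Longrightarrow> (s, y + (neg_tetris ^^ j) g, b \<or> j = 0) \<in> extensions k g R"
  unfolding extensions_def by blast

text \<open>After the choice of \<open>g\<close>, a partial sum may be extended by an iterate of \<open>g\<close> or left alone,
  and it may be declared complete if it contains a summand with exponent 0.\<close>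

definition next_states ::
  "nat \<Rightarrow> (nat \<Rightarrow> int) \<Rightarrow> ((nat \<Rightarrow> int) list \<times> (nat \<Rightarrow> int) \<times> bool) set \<Rightarrow>
    ((nat \<Rightarrow> int) list \<times> (nat \<Rightarrow> int) \<times> bool) set" where
  "next_states k g R =
     extensions k g R \<union> {(s @ [y], 0, False) | s y. (s, y, True) \<in> extensions k g R}"

definition layered :: "nat \<Rightarrow> (((nat \<Rightarrow> int) \<Rightarrow> bool) \<Rightarrow> bool) \<Rightarrow> bool" where
  "layered k u \<longleftrightarrow> (\<forall>i\<le>k. (push neg_tetris ^^ i) u \<in> fin_ultra (k - i)) \<and>
     (\<forall>i\<le>k. \<forall>j\<le>k. (push neg_tetris ^^ i) u \<oplus> (push neg_tetris ^^ j) u =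
        (push neg_tetris ^^ min i j) u)"

lemma layered_fin_ultra: "layered k u \<Longrightarrow> u \<in> fin_ultra k"
  by (auto simp: layered_def dest: spec[of _ 0])

text \<open>The equation \<open>S\<^sup>j u \<oplus> S\<^sup>i u = S\<^bsup>min j i\<^esup> u\<close> in terms of quantifiers.\<close>

lemma layered_absorb:
  assumes "layered k u" "j \<le> k" "i \<le> k"
  shows "u (\<lambda>g. (push neg_tetris ^^ i) u (\<lambda>z. D ((neg_tetris ^^ j) g + z))) \<longleftrightarrow>
    (push neg_tetris ^^ min j i) u D"
proof -
  have "(push neg_tetris ^^ j) u \<oplus> (push neg_tetris ^^ i) u = (push neg_tetris ^^ min j i) u"
    using assms by (simp add: layered_def)
  then have "((push neg_tetris ^^ j) u \<oplus> (push neg_tetris ^^ i) u) D \<longleftrightarrow>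
     (push neg_tetris ^^ min j i) u D" by simp
  then show ?thesis
    unfolding uf_add_def by (simp only: iterated_push[of j] push_def[of "neg_tetris ^^ j"])
qed

text \<open>Adding \<open>S\<^sup>j g\<close> to the partial sum turns the condition with exponent \<open>i\<close> for the new state,
  required for almost all \<open>g\<close>, into the condition with exponent \<open>min j i\<close> for the old state. If \<open>b\<close>
  holds, all exponents are available; if not, then \<open>min j i = 0\<close> in all cases that are required.\<close>

lemma promising_extend:
  assumes lay: "layered k u" and prom: "promising k u A (s, y, b)" and j: "j \<le> k"
  shows "u (\<lambda>g. promising k u A (s, y + (neg_tetris ^^ j) g, b \<or> j = 0))"
proof -
  have ul: "ultra u" using layered_fin_ultra[OF lay] by (rule fin_ultraD)
  let ?D = "\<lambda>z. A s (y + z)"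
  have D: "u ?D" "b \<Longrightarrow> i \<le> k \<Longrightarrow> (push neg_tetris ^^ i) u ?D" for i
    using prom by (simp_all add: promising_def)
  have low: "u (\<lambda>g. u (\<lambda>z. ?D ((neg_tetris ^^ j) g + z)))"
    using layered_absorb[OF lay j, of 0 ?D] D(1) by simp
  have all: "u (\<lambda>g. \<forall>i\<in>{..k}. (push neg_tetris ^^ i) u (\<lambda>z. ?D ((neg_tetris ^^ j) g + z)))"
    if "b \<or> j = 0"
  proof -
    have "(push neg_tetris ^^ min j i) u ?D" if "i \<le> k" for i
      using \<open>b \<or> j = 0\<close> D(1) D(2)[of "min j i"] j by (cases b) auto
    then have "u (\<lambda>g. (push neg_tetris ^^ i) u (\<lambda>z. ?D ((neg_tetris ^^ j) g + z)))"
      if "i \<le> k" for i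
      using layered_absorb[OF lay j that, of ?D] that by blast
    then show ?thesis
      unfolding ultra_ball[OF ul finite_atMost] by blast
  qed
  show ?thesis
    using low all ultra_conj[OF ul] by (cases "b \<or> j = 0") (simp_all add: promising_def add.assoc)
qed

lemma next_states_finite: "finite R \<Longrightarrow> finite (next_states k g R)"
proof -
  assume R: "finite R"
  have "extensions k g R \<subseteq> R \<union> (\<lambda>((s, y, b), j). (s, y + (neg_tetris ^^ j) g, b \<or> j = 0)) ` (R \<times> {..k})"
    unfolding extensions_def by force
  then have E: "finite (extensions k g R)" by (rule finite_subset) (use R in simp)
  have "next_states k g R \<subseteq> extensions k g R \<union> (\<lambda>(s, y, b). (s @ [y], 0, False)) ` extensions k g R"
    unfolding next_states_def by force
  then show ?thesis by (rule finite_subset) (use E in simp)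
qed

lemma promising_next:
  assumes lay: "layered k u" and A: "\<And>t. u (A t)"
    and R: "finite R" "\<forall>\<sigma>\<in>R. promising k u A \<sigma>"
  shows "u (\<lambda>g. \<forall>\<sigma>\<in>next_states k g R. promising k u A \<sigma>)"
proof -
  have ul: "ultra u" using layered_fin_ultra[OF lay] by (rule fin_ultraD)
  have "u (\<lambda>g. \<forall>\<sigma>\<in>R. \<forall>j\<in>{..k}. promising k u A
          (fst \<sigma>, fst (snd \<sigma>) + (neg_tetris ^^ j) g, snd (snd \<sigma>) \<or> j = 0))"
    unfolding ultra_ball[OF ul R(1)] ultra_ball[OF ul finite_atMost]
    using promising_extend[OF lay] R(2) by simp
  then show ?thesis
  proof (rule ultra_mono[OF ul])
    fix g assume g: "\<forall>\<sigma>\<in>R. \<forall>j\<in>{..k}. promising k u A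
          (fst \<sigma>, fst (snd \<sigma>) + (neg_tetris ^^ j) g, snd (snd \<sigma>) \<or> j = 0)"
    have "promising k u A \<sigma>" if "\<sigma> \<in> extensions k g R" for \<sigma>
      using that R(2) g unfolding extensions_def by fastforce
    moreover have "promising k u A (s @ [y], 0, False)" for s y
      using A by (simp add: promising_def)
    ultimately show "\<forall>\<sigma>\<in>next_states k g R. promising k u A \<sigma>"
      unfolding next_states_def by blast
  qed
qed

lemma supp_FIN_nonempty:
  assumes "p \<in> FIN_pm k" "k \<ge> 1" shows "supp p \<noteq> {}"
proof -
  obtain a where "\<bar>p a\<bar> = int k" using assms by (auto simp: FIN_pm_iff)
  then have "a \<in> supp p" using assms(2) by (auto simp: supp_def)
  then show ?thesis by blast
qed

text \<open>Only finitely many states arise from finitely many choices, and each of them stays promising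
  for almost every next vector. So the choice never gets stuck.\<close>

lemma generic_blocks:
  assumes lay: "layered k u" and A: "\<And>t. u (A t)" and "k \<ge> 1"
  obtains g R where "R 0 = {([], 0, False)}" "\<And>n. R (Suc n) = next_states k (g n) (R n)"
    "\<And>n \<sigma>. \<sigma> \<in> R n \<Longrightarrow> promising k u A \<sigma>" "\<And>n. g n \<in> FIN_pm k"
    "\<And>n m. \<lbrakk>n < m\<rbrakk> \<Longrightarrow> \<forall>a\<in>supp (g n). \<forall>b\<in>supp (g m). a < b"
proof -
  have ul: "ultra u" using layered_fin_ultra[OF lay] by (rule fin_ultraD)
  let ?pr = "promising k u A"
  have pick: "\<exists>g\<in>FIN_pm k. (\<forall>i<N. g i = 0) \<and> (\<forall>\<sigma>\<in>next_states k g R. ?pr \<sigma>)"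
    if "finite R" "\<forall>\<sigma>\<in>R. ?pr \<sigma>" for R and N :: nat
  proof -
    have "u (\<lambda>g. g \<in> FIN_pm k \<and> (\<forall>i<N. g i = 0) \<and> (\<forall>\<sigma>\<in>next_states k g R. ?pr \<sigma>))"
      using fin_ultraD[OF layered_fin_ultra[OF lay]] promising_next[where A = A, OF lay A that]
      by (simp add: ultra_conj[OF ul])
    from ultra_ex[OF ul, OF this] show ?thesis by blast
  qed
  define Inv where "Inv n x \<longleftrightarrow> (n = 0 \<longrightarrow> fst x = {([], 0, False)}) \<and>
    finite (fst x) \<and> (\<forall>\<sigma>\<in>fst x. ?pr \<sigma>) \<and> snd x \<in> FIN_pm k \<and>
    (\<forall>\<sigma>\<in>next_states k (snd x) (fst x). ?pr \<sigma>)" for n :: nat and x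
  define Step where "Step (n::nat) x y \<longleftrightarrow> fst y = next_states k (snd x) (fst x) \<and>
    (\<forall>a\<in>supp (snd x). \<forall>b\<in>supp (snd y). a < b)" for n x y
  have "\<exists>f. \<forall>n. Inv n (f n) \<and> Step n (f n) (f (Suc n))"
  proof (rule dependent_nat_choice)
    have "?pr ([], 0, False)" using A by (simp add: promising_def)
    then have "\<exists>g\<in>FIN_pm k. (\<forall>i<0. g i = 0) \<and>
        (\<forall>\<sigma>\<in>next_states k g {([], 0, False)}. ?pr \<sigma>)"
      by (intro pick) auto
    then obtain g where "g \<in> FIN_pm k" "\<forall>\<sigma>\<in>next_states k g {([], 0, False)}. ?pr \<sigma>" by blast
    then have "Inv 0 ({([], 0, False)}, g)"
      using \<open>?pr ([], 0, False)\<close> by (simp add: Inv_def)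
    then show "\<exists>x. Inv 0 x" by blast
  next
    fix x n assume x: "Inv n x"
    let ?R = "next_states k (snd x) (fst x)"
    have R: "finite ?R" "\<forall>\<sigma>\<in>?R. ?pr \<sigma>" using x next_states_finite by (auto simp: Inv_def)
    have "finite (supp (snd x))" using x by (auto simp: Inv_def finite_supp_FIN)
    then obtain N where N: "\<forall>a\<in>supp (snd x). a < N" using finite_nat_set_iff_bounded by blast
    obtain g where g: "g \<in> FIN_pm k" "\<forall>i<N. g i = 0" "\<forall>\<sigma>\<in>next_states k g ?R. ?pr \<sigma>"
      using pick[OF R, of N] by blast
    have "a < b" if "a \<in> supp (snd x)" "b \<in> supp g" for a b
      using N g(2) that by (metis (mono_tags) mem_Collect_eq not_less order.strict_trans2 supp_def)
    then have "Step n x (?R, g)" by (simp add: Step_def)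
    moreover have "Inv (Suc n) (?R, g)" using R g by (simp add: Inv_def)
    ultimately show "\<exists>y. Inv (Suc n) y \<and> Step n x y" by blast
  qed
  then obtain f where f: "\<And>n. Inv n (f n)" "\<And>n. Step n (f n) (f (Suc n))" by blast
  define g where "g n = snd (f n)" for n
  have gF: "g n \<in> FIN_pm k" for n using f(1)[of n] by (simp add: Inv_def g_def)
  have nonempty: "supp (g n) \<noteq> {}" for n by (rule supp_FIN_nonempty[OF gF \<open>k \<ge> 1\<close>])
  have less: "\<forall>a\<in>supp (g n). \<forall>b\<in>supp (g m). a < b" if "n < m" for n m
    using that
  proof (induction m)
    case (Suc m)
    have st: "\<forall>a\<in>supp (g m). \<forall>b\<in>supp (g (Suc m)). a < b"
      using f(2)[of m] by (simp add: Step_def g_def)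
    show ?case
    proof (cases "n = m")
      case False
      then have "\<forall>a\<in>supp (g n). \<forall>b\<in>supp (g m). a < b" using Suc by simp
      then show ?thesis using st nonempty[of m] by (meson ex_in_conv order.strict_trans)
    qed (use st in simp)
  qed simp
  show ?thesis
    by (rule that[of "\<lambda>n. fst (f n)" g])
      (use f gF less in \<open>auto simp: Inv_def Step_def g_def\<close>)
qed

lemma block_lessI:
  assumes "p \<in> FIN_pm k" "q \<in> FIN_pm k" "k \<ge> 1" "\<forall>a\<in>supp p. \<forall>b\<in>supp q. a < b"
  shows "block_less p q"
proof -
  have "supp r \<noteq> {} \<and> finite (supp r)" if "r \<in> FIN_pm k" for r
    using supp_FIN_nonempty[OF that \<open>k \<ge> 1\<close>] finite_supp_FIN[OF that] by blast
  then show ?thesis using assms unfolding block_less_def by simp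
qed

lemma block_seqs_infinity:
  "P \<in> block_seqs k \<infinity> \<longleftrightarrow> (\<forall>n. P n \<in> FIN_pm k) \<and> (\<forall>n m. n < m \<longrightarrow> block_less (P n) (P m))"
  by (auto simp: block_seqs_def)

text \<open>The block subsequences of \<open>g\<close> generated by \<open>neg_tetris\<close> without free signs, presented by the
  index sets and exponents of their terms. For vectors of \<open>FIN_pm k\<close> the exponent \<open>k\<close> contributes
  zero; admitting it lets the exchange of exponents \<open>j\<close> and \<open>j + 1\<close> below apply for every
  \<open>j < k\<close>.\<close>

definition neg_subseqs :: "nat \<Rightarrow> (nat \<Rightarrow> nat \<Rightarrow> int) \<Rightarrow> (nat \<Rightarrow> nat \<Rightarrow> int) set" where
  "neg_subseqs k g =
     {(\<lambda>n m. \<Sum>i\<in>I n. (neg_tetris ^^ J n i) (g i) m) | I J.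
        (\<forall>n. finite (I n)) \<and> (\<forall>n. \<forall>a\<in>I n. \<forall>b\<in>I (Suc n). a < b) \<and>
        (\<forall>n. \<forall>i\<in>I n. J n i \<le> k) \<and> (\<forall>n. \<exists>i\<in>I n. J n i = 0)}"

text \<open>Each sequence in \<open>neg_subseqs k g\<close> is assembled through reachable states: from the stage at
  which its first \<open>n\<close> terms are complete, the partial sums of the next term are followed until its
  last index has been processed. The state reached then is promising with the flag set, so the
  term lies in the tree.\<close>

theorem generic_blocks_homogeneous:
  assumes lay: "layered k u" and A: "\<And>t. u (A t)" and k: "k \<ge> 1"
  shows "\<exists>g\<in>block_seqs k \<infinity>. neg_subseqs k g \<subseteq> branches [] A"
proof -
  obtain g R where R0: "R 0 = {([], 0, False)}"
    and RS: "\<And>n. R (Suc n) = next_states k (g n) (R n)"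
    and prom: "\<And>n \<sigma>. \<sigma> \<in> R n \<Longrightarrow> promising k u A \<sigma>"
    and gF: "\<And>n. g n \<in> FIN_pm k"
    and less: "\<And>n m. n < m \<Longrightarrow> \<forall>a\<in>supp (g n). \<forall>b\<in>supp (g m). a < b"
    by (rule generic_blocks[where A = A, OF lay A k], rule that)
  have g: "g \<in> block_seqs k \<infinity>"
    using gF less k by (auto simp: block_seqs_infinity intro!: block_lessI)
  have combine: "x \<in> branches [] A"
    if fin: "\<And>n. finite (I n)" and ord: "\<And>n a b. a \<in> I n \<Longrightarrow> b \<in> I (Suc n) \<Longrightarrow> a < b"
      and J: "\<And>n i. i \<in> I n \<Longrightarrow> J n i \<le> k" and zero: "\<And>n. \<exists>i\<in>I n. J n i = 0"
      and x: "\<And>n. x n = (\<lambda>m. \<Sum>i\<in>I n. (neg_tetris ^^ J n i) (g i) m)" for x I J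
  proof -
    have ne: "I n \<noteq> {}" for n using zero by blast
    \<comment> \<open>The stage at which the terms before the \<open>n\<close>-th are complete.\<close>
    define start where "start n = (case n of 0 \<Rightarrow> 0 | Suc n \<Rightarrow> Suc (Max (I n)))" for n
    have start_Suc: "start (Suc n) = Suc (Max (I n))" for n by (simp add: start_def)
    have start_le: "start n \<le> a" if "a \<in> I n" for n a
    proof (cases n)
      case (Suc m)
      then have "Max (I m) < a" using that ord fin ne by simp
      then show ?thesis using Suc by (simp add: start_def)
    qed (simp add: start_def)
    define y where "y n l = (\<lambda>m. \<Sum>i\<in>I n \<inter> {..<l}. (neg_tetris ^^ J n i) (g i) m)" for n l
    define b where "b n l \<longleftrightarrow> (\<exists>i\<in>I n \<inter> {..<l}. J n i = 0)" for n l
    have reach: "(map x [0..<n], y n l, b n l) \<in> R l"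
      if "(map x [0..<n], 0, False) \<in> R (start n)" "start n \<le> l" for n l
      using that(2)
    proof (induction l rule: dec_induct)
      case base
      have "I n \<inter> {..<start n} = {}" using start_le by force
      then have "y n (start n) = 0" "b n (start n) = False"
        by (auto simp: y_def b_def)
      then show ?case using that(1) by metis
    next
      case (step l)
      show ?case
      proof (cases "l \<in> I n")
        case True
        then have split: "I n \<inter> {..<Suc l} = insert l (I n \<inter> {..<l})" by (auto simp: less_Suc_eq)
        have y_Suc: "y n (Suc l) = y n l + (neg_tetris ^^ J n l) (g l)"
          unfolding y_def split by (simp add: fin fun_eq_iff)
        have b_Suc: "b n (Suc l) \<longleftrightarrow> b n l \<or> J n l = 0" unfolding b_def split by auto
        have "(map x [0..<n], y n (Suc l), b n (Suc l)) \<in> extensions k (g l) (R l)"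
          unfolding y_Suc b_Suc by (rule extensionsI[OF step.IH J[OF True]])
        then show ?thesis by (simp add: RS next_states_def)
      next
        case False
        then have "I n \<inter> {..<Suc l} = I n \<inter> {..<l}" by (auto simp: less_Suc_eq)
        then have "y n (Suc l) = y n l" "b n (Suc l) = b n l" by (simp_all add: y_def b_def)
        then show ?thesis using step.IH by (simp add: RS next_states_def extensions_def)
      qed
    qed
    have complete: "(map x [0..<n], x n, True) \<in> R (start (Suc n))"
      if "(map x [0..<n], 0, False) \<in> R (start n)" for n
    proof -
      have "start n \<le> start (Suc n)"
        using start_le[OF Max_in[OF fin ne], of n] unfolding start_Suc by (rule le_SucI)
      moreover have all: "I n \<inter> {..<start (Suc n)} = I n" using fin by (auto simp: start_Suc less_Suc_eq_le)
      have "y n (start (Suc n)) = x n" "b n (start (Suc n))"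
        unfolding y_def b_def all using x zero by auto
      ultimately show ?thesis using reach[OF that, of "start (Suc n)"] by simp
    qed
    have closed: "(s @ [z], 0, False) \<in> R l" if "(s, z, True) \<in> R l" for s z l
    proof (cases l)
      case 0 then show ?thesis using that R0 by simp
    next
      case (Suc m)
      then show ?thesis using that by (auto simp: RS next_states_def)
    qed
    have init: "(map x [0..<n], 0, False) \<in> R (start n)" for n
    proof (induction n)
      case 0 then show ?case using R0 by (simp add: start_def zero_fun_def)
    next
      case (Suc n) then show ?case using closed[OF complete[OF Suc]] by (simp add: zero_fun_def)
    qed
    have "A (map x [0..<n]) (x n)" for n
    proof -
      have "(push neg_tetris ^^ k) u (\<lambda>z. A (map x [0..<n]) (x n + z))"
        using prom[OF complete[OF init]] by (simp add: promising_def)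
      moreover have "(push neg_tetris ^^ k) u \<in> fin_ultra 0" using lay by (auto simp: layered_def)
      ultimately show ?thesis using fin_ultra_0 by force
    qed
    then show ?thesis by (simp add: branches_def)
  qed
  have "neg_subseqs k g \<subseteq> branches [] A"
    unfolding neg_subseqs_def
  proof (intro subsetI, elim CollectE exE conjE)
    fix x :: "nat \<Rightarrow> nat \<Rightarrow> int" and I :: "nat \<Rightarrow> nat set" and J :: "nat \<Rightarrow> nat \<Rightarrow> nat"
    assume x: "x = (\<lambda>n m. \<Sum>i\<in>I n. (neg_tetris ^^ J n i) (g i) m)"
      and IJ: "\<forall>n. finite (I n)" "\<forall>n. \<forall>a\<in>I n. \<forall>b\<in>I (Suc n). a < b"
        "\<forall>n. \<forall>i\<in>I n. J n i \<le> k" "\<forall>n. \<exists>i\<in>I n. J n i = 0"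
    show "x \<in> branches [] A"
      by (rule combine[where I = I and J = J]) (use IJ x in simp_all)
  qed
  then show ?thesis using g by blast
qed

section \<open>Souslin sets of block sequences\<close>

lemma tree_openI:
  assumes "ultra u" "\<And>x. x \<in> X \<Longrightarrow> \<exists>m::nat. \<forall>y. (\<forall>i<m. y i = x i) \<longrightarrow> y \<in> X"
  shows "tree_open u X"
  unfolding tree_open_def
proof
  fix x assume "x \<in> X"
  then obtain m where m: "\<And>y. (\<forall>i<m. y i = x i) \<Longrightarrow> y \<in> X" using assms(2) by blast
  have "branches (map x [0..<m]) (\<lambda>_ _. True) \<subseteq> X"
    using m by (auto simp: branches_def)
  moreover have "x \<in> branches (map x [0..<m]) (\<lambda>_ _. True)" by (simp add: branches_def)
  ultimately show "\<exists>s A. (\<forall>t. u (A t)) \<and> x \<in> branches s A \<and> branches s A \<subseteq> X"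
    using ultra_True[OF assms(1)] by (intro exI[of _ "map x [0..<m]"] exI[of _ "\<lambda>_ _. True"]) simp
qed

lemma decided_block_seqs:
  assumes u: "ultra u"
  shows "decided u (block_seqs k \<infinity>)"
proof -
  have "tree_open u (- block_seqs k \<infinity>)"
  proof (rule tree_openI[OF u])
    fix x assume "x \<in> - block_seqs k \<infinity>"
    then consider n where "x n \<notin> FIN_pm k" | n m where "n < m" "\<not> block_less (x n) (x m)"
      by (auto simp: block_seqs_infinity)
    then show "\<exists>m::nat. \<forall>y. (\<forall>i<m. y i = x i) \<longrightarrow> y \<in> - block_seqs k \<infinity>"
    proof cases
      case 1
      then show ?thesis by (intro exI[of _ "Suc n"]) (metis ComplI block_seqs_infinity lessI)
    next
      case 2
      then show ?thesis
        by (intro exI[of _ "Suc m"]) (metis ComplI block_seqs_infinity less_Suc_eq order.strict_trans)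
    qed
  qed
  then show ?thesis using decided_Compl[OF u tree_open_decided[OF u]] by force
qed

lemma block_topology_open_local:
  assumes "openin (block_topology k) U" "x \<in> U"
  shows "\<exists>m::nat. \<forall>y\<in>block_seqs k \<infinity>. (\<forall>i<m. y i = x i) \<longrightarrow> y \<in> U"
proof -
  have "generate_topology_on
     {{p \<in> block_seqs k \<infinity>. \<forall>i<m. p i = q i} | (m :: nat) q. q \<in> block_seqs k (enat m)} U"
    using assms(1) unfolding block_topology_def by (rule openin_topology_generated_by)
  then show ?thesis using assms(2)
  proof (induction arbitrary: x)
    case (Int a b)
    have "x \<in> a" "x \<in> b" using Int.prems by auto
    then obtain m n where "\<forall>y\<in>block_seqs k \<infinity>. (\<forall>i<m. y i = x i) \<longrightarrow> y \<in> a"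
      "\<forall>y\<in>block_seqs k \<infinity>. (\<forall>i<n. y i = x i) \<longrightarrow> y \<in> b"
      using Int.IH(1)[of x] Int.IH(2)[of x] by auto
    then show ?case by (intro exI[of _ "max m n"]) auto
  next
    case (UN K)
    then obtain U where U: "U \<in> K" "x \<in> U" by blast
    show ?case using UN.IH[OF U] U(1) by blast
  next
    case (Basis s)
    then obtain m q where "s = {p \<in> block_seqs k \<infinity>. \<forall>i<m. p i = q i}" by blast
    then show ?case using Basis.prems by (intro exI[of _ m]) auto
  qed simp
qed

text \<open>The space of block sequences is closed, rather than open, among all sequences. So an open
  set of block sequences is the intersection of a closed set and an open set of sequences.\<close>

lemma decided_open:
  assumes u: "ultra u" and U: "openin (block_topology k) U"
  shows "decided u U"
proof -
  define V where "V = {x. \<exists>m::nat. \<forall>y\<in>block_seqs k \<infinity>. (\<forall>i<m. y i = x i) \<longrightarrow> y \<in> U}"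
  have "tree_open u V"
  proof (rule tree_openI[OF u])
    fix x assume "x \<in> V"
    then obtain m where m: "\<forall>y\<in>block_seqs k \<infinity>. (\<forall>i<m. y i = x i) \<longrightarrow> y \<in> U"
      by (auto simp: V_def)
    have "y \<in> V" if "\<forall>i<m. y i = x i" for y
      unfolding V_def using m that by (intro CollectI exI[of _ m]) simp
    then show "\<exists>m::nat. \<forall>y. (\<forall>i<m. y i = x i) \<longrightarrow> y \<in> V" by blast
  qed
  then have "decided u (V \<inter> block_seqs k \<infinity>)"
    by (intro decided_Int[OF u] tree_open_decided[OF u] decided_block_seqs[OF u])
  moreover have "U \<subseteq> block_seqs k \<infinity>"
    using openin_subset[OF U] by (simp add: topspace_block_topology)
  then have "U = V \<inter> block_seqs k \<infinity>"
    using block_topology_open_local[OF U] by (auto simp: V_def)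
  ultimately show ?thesis by simp
qed

lemma decided_souslin_sets:
  assumes u: "ultra u" and X: "X \<in> souslin_sets (block_topology k)"
  shows "decided u X"
proof -
  let ?B = "block_seqs k \<infinity>"
  let ?M = "{Y. Y \<subseteq> ?B \<and> decided u Y}"
  have e: "decided u {}" using decided_Compl[OF u decided_UNIV[OF u]] by simp
  have "algebra ?B ?M"
    unfolding algebra_iff_Un
    using decided_Diff[OF u decided_block_seqs[OF u]] decided_Un[OF u] e by auto
  moreover have "{U. openin (block_topology k) U} \<subseteq> ?M"
    using decided_open[OF u] openin_subset[of "block_topology k"]
    by (auto simp: topspace_block_topology)
  moreover have "souslin_operation A \<in> ?M" if A: "range A \<subseteq> ?M" for A :: "nat list \<Rightarrow> _"
  proof -
    have "decided u (souslin_operation A)" by (rule decided_souslin[OF u]) (use A in blast)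
    moreover have "souslin_operation A \<subseteq> A []" 
    proof
      fix y assume "y \<in> souslin_operation A"
      then obtain x where "y \<in> (\<Inter>n. A (map x [0..<n]))" unfolding souslin_operation_def by blast
      then have "y \<in> A (map x [0..<0])" by blast
      then show "y \<in> A []" by simp
    qed
    ultimately show ?thesis using A by blast
  qed
  ultimately have "X \<in> ?M"
    using X unfolding souslin_sets_def topspace_block_topology by blast
  then show ?thesis by blast
qed

section \<open>Absorbing signs by an error of one\<close>

lemma iterated_neg_tetris_zero: "p x = 0 \<Longrightarrow> (neg_tetris ^^ j) p x = 0"
  by (induction j) (simp_all add: neg_tetris_apply)

lemma iterated_neg_tetris_add:
  assumes "\<And>n. p n = 0 \<or> q n = 0"
  shows "(neg_tetris ^^ j) (p + q) = (neg_tetris ^^ j) p + (neg_tetris ^^ j) q"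
proof (induction j)
  case (Suc j)
  have "(neg_tetris ^^ j) p n = 0 \<or> (neg_tetris ^^ j) q n = 0" for n
    using assms[of n] iterated_neg_tetris_zero by blast
  then have "neg_tetris ((neg_tetris ^^ j) p + (neg_tetris ^^ j) q) =
      neg_tetris ((neg_tetris ^^ j) p) + neg_tetris ((neg_tetris ^^ j) q)"
    by (rule neg_tetris_add)
  then show ?case by (simp only: funpow.simps comp_apply Suc)
qed simp

lemma abs_iterated_neg_tetris: "\<bar>(neg_tetris ^^ j) p x\<bar> = max 0 (\<bar>p x\<bar> - int j)"
  by (induction j) (auto simp: abs_neg_tetris)

lemma iterated_tetris: "(tetris ^^ j) p x = (-1) ^ j * (neg_tetris ^^ j) p x"
proof (induction j arbitrary: x)
  case (Suc j)
  have "(-1::int) ^ j = 1 \<or> (-1::int) ^ j = -1" by (cases "even j") auto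
  then show ?case using Suc by (auto simp: tetris_def neg_tetris_apply)
qed simp

lemma neg_tetris_close: "\<bar>p x + neg_tetris p x\<bar> \<le> 1"
  by (auto simp: neg_tetris_apply)

text \<open>With disjoint supports, errors of different summands do not add up.\<close>

lemma abs_sum_single:
  fixes d :: "'a \<Rightarrow> int"
  assumes "finite N" "\<And>a. a \<in> N \<Longrightarrow> \<bar>d a\<bar> \<le> 1"
    "\<And>a b. a \<in> N \<Longrightarrow> b \<in> N \<Longrightarrow> d a \<noteq> 0 \<Longrightarrow> d b \<noteq> 0 \<Longrightarrow> a = b"
  shows "\<bar>sum d N\<bar> \<le> 1"
proof (cases "\<exists>a\<in>N. d a \<noteq> 0")
  case True
  then obtain a where a: "a \<in> N" "d a \<noteq> 0" by blast
  then have "sum d N = d a + sum d (N - {a})" by (simp add: assms(1) sum.remove)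
  moreover have "sum d (N - {a}) = 0" by (rule sum.neutral) (use assms(3) a in blast)
  ultimately show ?thesis using assms(2)[OF a(1)] by simp
qed simp

lemma sum_pairs:
  fixes f :: "nat \<Rightarrow> 'a::comm_monoid_add"
  assumes "finite N"
  shows "finite {i. i div 2 \<in> N} \<and> (\<Sum>i | i div 2 \<in> N. f i) = (\<Sum>a\<in>N. f (2 * a) + f (2 * a + 1))"
  using assms
proof induction
  case (insert a N)
  have eq: "{i. i div 2 \<in> insert a N} = insert (2 * a) (insert (2 * a + 1) {i. i div 2 \<in> N})" by auto
  show ?case unfolding eq using insert by (simp add: add.assoc)
qed simp

lemma span_pm_indexed:
  assumes "q \<in> span_pm k \<infinity> P"
  shows "\<exists>N e j. finite N \<and> (\<forall>a\<in>N. e a \<in> {1, -1} \<and> j a < k) \<and> (\<exists>a\<in>N. j a = 0) \<and>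
    q = (\<lambda>x. \<Sum>a\<in>N. e a * (tetris ^^ j a) (P a) x)"
  using assms unfolding span_pm_def mem_Collect_eq
proof (elim exE conjE)
  fix m :: nat and n \<epsilon> j
  assume q: "q = (\<lambda>x. \<Sum>i\<le>m. \<epsilon> i * (tetris ^^ j i) (P (n i)) x)"
    and n: "strict_mono_on {..m} n" and \<epsilon>: "\<forall>i\<le>m. \<epsilon> i \<in> {1, -1}" and j: "\<forall>i\<le>m. j i < k"
    and z: "Min (j ` {..m}) = 0"
  have inj: "inj_on n {..m}" 
  proof (rule inj_onI, rule ccontr)
    fix i i' assume "i \<in> {..m}" "i' \<in> {..m}" "n i = n i'" "i \<noteq> i'"
    moreover have "i < i' \<or> i' < i" using \<open>i \<noteq> i'\<close> by auto
    ultimately show False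
      using strict_mono_onD[OF n, of i i'] strict_mono_onD[OF n, of i' i] by auto
  qed
  define inv where "inv = inv_into {..m} n"
  have inv: "inv (n i) = i" if "i \<le> m" for i
    using inj that by (simp add: inv_def inv_into_f_f)
  have "(\<Sum>a\<in>n ` {..m}. \<epsilon> (inv a) * (tetris ^^ j (inv a)) (P a) x) =
      (\<Sum>i\<le>m. \<epsilon> i * (tetris ^^ j i) (P (n i)) x)" for x
    by (subst sum.reindex[OF inj]) (auto intro!: sum.cong simp: inv)
  moreover have "0 \<in> j ` {..m}" using Min_in[of "j ` {..m}"] z by simp
  then have "\<exists>a\<in>n ` {..m}. j (inv a) = 0" using inv by force
  ultimately show ?thesis
    using \<epsilon> j inv q
    by (intro exI[of _ "n ` {..m}"] exI[of _ "\<epsilon> \<circ> inv"] exI[of _ "j \<circ> inv"]) auto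
qed

lemma block_seqs_supp_less:
  assumes "g \<in> block_seqs k \<infinity>" "n < m" "a \<in> supp (g n)" "b \<in> supp (g m)"
  shows "a < b"
proof -
  have "block_less (g n) (g m)" "finite (supp (g n))" "finite (supp (g m))"
    using assms finite_supp_FIN by (auto simp: block_seqs_infinity)
  then show ?thesis
    using assms(3,4) unfolding block_less_def
    by (meson Max_ge Min_le order.strict_trans1 order.strict_trans2)
qed

lemma block_seqs_disjoint:
  assumes "g \<in> block_seqs k \<infinity>" "n \<noteq> m"
  shows "g n x = 0 \<or> g m x = 0"
  using block_seqs_supp_less[OF assms(1), of n m x x] block_seqs_supp_less[OF assms(1), of m n x x] assms(2)
  by (auto simp: supp_def nat_neq_iff)

text \<open>The block sequence of the conclusion. The second summand lies one layer lower, so that an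
  exchange of the two exponents can replace a change of sign.\<close>

lemma paired_block_seq:
  assumes g: "g \<in> block_seqs k \<infinity>" and k: "k \<ge> 1"
  shows "(\<lambda>n. g (2 * n) + neg_tetris (g (2 * n + 1))) \<in> block_seqs k \<infinity>"
proof -
  let ?P = "\<lambda>n. g (2 * n) + neg_tetris (g (2 * n + 1))"
  have gF: "g n \<in> FIN_pm k" for n using g by (simp add: block_seqs_infinity)
  have P: "?P n \<in> FIN_pm k" for n
  proof -
    have "neg_tetris (g (2 * n + 1)) \<in> FIN_pm (k - 1)"
      by (rule neg_tetris_FIN) (use gF k in simp)
    moreover have "g (2 * n) x = 0 \<or> neg_tetris (g (2 * n + 1)) x = 0" for x
      using block_seqs_disjoint[OF g, of "2 * n" "2 * n + 1" x] by (auto simp: neg_tetris_apply)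
    ultimately have "?P n \<in> FIN_pm (max k (k - 1))" using FIN_pm_add[OF gF] by blast
    then show ?thesis by (simp add: max_absorb1)
  qed
  have supp: "supp (?P n) \<subseteq> supp (g (2 * n)) \<union> supp (g (2 * n + 1))" for n
    by (auto simp: supp_def neg_tetris_apply)
  have "block_less (?P n) (?P m)" if "n < m" for n m
  proof (rule block_lessI[OF P P k], intro ballI)
    fix a b assume "a \<in> supp (?P n)" "b \<in> supp (?P m)"
    then obtain i i' where "i \<in> {2 * n, 2 * n + 1}" "a \<in> supp (g i)"
      "i' \<in> {2 * m, 2 * m + 1}" "b \<in> supp (g i')" using supp by blast
    moreover have "i < i'" using calculation that by auto
    ultimately show "a < b" using block_seqs_supp_less[OF g] by blast
  qed
  then show ?thesis using P by (simp add: block_seqs_infinity)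
qed

text \<open>A term of \<open>Q\<close> is a sum of \<open>\<delta> (S\<^sup>j g\<^bsub>2a\<^esub> + S\<^bsup>j+1\<^esup> g\<^bsub>2a+1\<^esub>)\<close> over its indices \<open>a\<close>, where
  \<open>\<delta>\<close> is a sign. For \<open>\<delta> = 1\<close> the summand is kept. For \<open>\<delta> = -1\<close> it is replaced by
  \<open>S\<^bsup>j+1\<^esup> g\<^bsub>2a\<^esub> + S\<^sup>j g\<^bsub>2a+1\<^esub>\<close>, which is within distance 1 as \<open>- p\<close> is close to \<open>S p\<close>.\<close>

lemma approximate_subsequence:
  assumes g: "g \<in> block_seqs k \<infinity>" and k: "k \<ge> 1"
    and Q: "Q \<in> block_subseqs_pm k (\<lambda>n. g (2 * n) + neg_tetris (g (2 * n + 1)))"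
  shows "\<exists>Q'\<in>neg_subseqs k g. dist_seq Q Q' \<le> 1"
proof -
  let ?P = "\<lambda>n. g (2 * n) + neg_tetris (g (2 * n + 1))"
  have gF: "g n \<in> FIN_pm k" for n using g by (simp add: block_seqs_infinity)
  have QB: "Q \<in> block_seqs k \<infinity>" and Qs: "\<And>n. Q n \<in> span_pm k \<infinity> ?P"
    using Q by (auto simp: block_subseqs_pm_def)
  define Rep where "Rep n = (\<lambda>(N, e, j). finite N \<and> (\<forall>a\<in>N. e a \<in> {1, -1} \<and> j a < k) \<and>
    (\<exists>a\<in>N. j a = 0) \<and> Q n = (\<lambda>x. \<Sum>a\<in>N. e a * (tetris ^^ j a) (?P a) x))" for n
  have "\<exists>t. Rep n t" for n using span_pm_indexed[OF Qs[of n]] by (simp add: Rep_def)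
  then obtain t where t: "\<And>n. Rep n (t n)" by metis
  define N e j where "N n = fst (t n)" and "e n = fst (snd (t n))" and "j n = snd (snd (t n))" for n
  have N: "finite (N n)" and e: "a \<in> N n \<Longrightarrow> e n a \<in> {1, -1}" and j: "a \<in> N n \<Longrightarrow> j n a < k"
    and zero: "\<exists>a\<in>N n. j n a = 0"
    and Qn: "Q n = (\<lambda>x. \<Sum>a\<in>N n. e n a * (tetris ^^ j n a) (?P a) x)" for n a
    using t[of n] unfolding Rep_def N_def e_def j_def by (simp_all add: case_prod_beta)
  define \<delta> :: "nat \<Rightarrow> nat \<Rightarrow> int" where "\<delta> n a = e n a * (-1) ^ j n a" for n a
  have \<delta>: "\<delta> n a = 1 \<or> \<delta> n a = -1" if "a \<in> N n" for n a
    using e[OF that] unfolding \<delta>_def by (cases "even (j n a)") auto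
  define D where "D n a x = \<delta> n a * ((neg_tetris ^^ j n a) (g (2 * a)) x +
      (neg_tetris ^^ Suc (j n a)) (g (2 * a + 1)) x)" for n a x
  have term_eq: "e n a * (tetris ^^ j n a) (?P a) x = D n a x" for n a x
  proof -
    have "g (2 * a) x = 0 \<or> neg_tetris (g (2 * a + 1)) x = 0" for x
      using block_seqs_disjoint[OF g, of "2 * a" "2 * a + 1" x] by (auto simp: neg_tetris_apply)
    then have "(neg_tetris ^^ j n a) (?P a) =
       (neg_tetris ^^ j n a) (g (2 * a)) + (neg_tetris ^^ j n a) (neg_tetris (g (2 * a + 1)))"
      by (rule iterated_neg_tetris_add)
    then show ?thesis
      by (simp add: iterated_tetris D_def \<delta>_def funpow_swap1)
  qed
  have QD: "Q n x = (\<Sum>a\<in>N n. D n a x)" for n x unfolding Qn term_eq by (rule refl)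
  have D_zero: "D n a x = 0" if "g (2 * a) x = 0" "g (2 * a + 1) x = 0" for n a x
    using that iterated_neg_tetris_zero[of _ x "Suc (j n a)"] iterated_neg_tetris_zero[of _ x "j n a"]
    unfolding D_def by auto
  \<comment> \<open>At a peak of \<open>g (2 * a)\<close> no exponent below \<open>k\<close> can cancel the value. So these peaks
    witness that the index sets of successive terms of \<open>Q\<close> are ordered like their supports.\<close>
  have "\<forall>a. \<exists>x. \<bar>g (2 * a) x\<bar> = int k" using gF by (auto simp: FIN_pm_iff)
  then obtain w where w: "\<And>a. \<bar>g (2 * a) (w a)\<bar> = int k" by metis
  have w_supp: "w a \<in> supp (g (2 * a))" for a using w[of a] k by (auto simp: supp_def)
  have w_Q: "w a \<in> supp (Q n)" if a: "a \<in> N n" for n a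
  proof -
    have ga: "g i (w a) = 0" if "i \<noteq> 2 * a" for i
      using block_seqs_disjoint[OF g that, of "w a"] w_supp[of a] by (auto simp: supp_def)
    have "(\<Sum>b\<in>N n - {a}. D n b (w a)) = 0"
    proof (rule sum.neutral, rule ballI)
      fix b assume "b \<in> N n - {a}"
      moreover have "2 * b + 1 \<noteq> 2 * a" by presburger
      ultimately show "D n b (w a) = 0" by (intro D_zero ga) auto
    qed
    then have "Q n (w a) = D n a (w a)" using sum.remove[OF N a, of "\<lambda>b. D n b (w a)"] QD by simp
    moreover have "(neg_tetris ^^ Suc (j n a)) (g (2 * a + 1)) (w a) = 0"
      by (rule iterated_neg_tetris_zero) (rule ga, presburger)
    moreover have "\<bar>(neg_tetris ^^ j n a) (g (2 * a)) (w a)\<bar> > 0"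
      unfolding abs_iterated_neg_tetris w using j[OF a] by simp
    ultimately have "Q n (w a) \<noteq> 0" using \<delta>[OF a] unfolding D_def by auto
    then show ?thesis by (simp add: supp_def)
  qed
  have N_less: "a < b" if "a \<in> N n" "b \<in> N (Suc n)" for n a b
  proof -
    have lt: "w a < w b" using block_seqs_supp_less[OF QB, of n "Suc n"] w_Q that by blast
    show ?thesis
    proof (rule ccontr)
      assume "\<not> a < b"
      then have "b = a \<or> 2 * b < 2 * a" by auto
      then show False using lt block_seqs_supp_less[OF g _ w_supp w_supp, of b a] by auto
    qed
  qed
  define I where "I n = {i. i div 2 \<in> N n}" for n
  \<comment> \<open>The larger exponent goes to the odd index if \<open>\<delta> = 1\<close> and to the even one if \<open>\<delta> = -1\<close>.\<close>
  define J where "J n i = j n (i div 2) + (if (\<delta> n (i div 2) = 1) = even i then 0 else 1)" for n i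
  have fin: "finite (I n)" for n
    unfolding I_def using sum_pairs[OF N, of n "\<lambda>_. 0 :: nat"] by blast
  have ord: "a < b" if "a \<in> I n" "b \<in> I (Suc n)" for n a b
  proof -
    have "a div 2 < b div 2" using N_less that by (simp add: I_def)
    then show ?thesis by (metis div_le_mono linorder_not_le)
  qed
  have J: "J n i \<le> k" if "i \<in> I n" for n i
    using j[of "i div 2" n] that by (auto simp: J_def I_def)
  have J0: "\<exists>i\<in>I n. J n i = 0" for n
  proof -
    obtain a where a: "a \<in> N n" "j n a = 0" using zero by blast
    show ?thesis
    proof (cases "\<delta> n a = 1")
      case True
      then show ?thesis using a by (intro bexI[of _ "2 * a"]) (auto simp: I_def J_def)
    next
      case False
      then show ?thesis using a by (intro bexI[of _ "2 * a + 1"]) (auto simp: I_def J_def)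
    qed
  qed
  let ?Q' = "\<lambda>n m. \<Sum>i\<in>I n. (neg_tetris ^^ J n i) (g i) m"
  have close: "\<bar>Q n x - ?Q' n x\<bar> \<le> 1" for n x
  proof -
    define E where "E a = (neg_tetris ^^ J n (2 * a)) (g (2 * a)) x +
        (neg_tetris ^^ J n (2 * a + 1)) (g (2 * a + 1)) x" for a
    have "?Q' n x = (\<Sum>a\<in>N n. E a)"
      unfolding I_def E_def using sum_pairs[OF N, where f = "\<lambda>i. (neg_tetris ^^ J n i) (g i) x"] by simp
    then have "Q n x - ?Q' n x = (\<Sum>a\<in>N n. D n a x - E a)" by (simp add: QD sum_subtractf)
    moreover have "\<bar>\<Sum>a\<in>N n. D n a x - E a\<bar> \<le> 1"
    proof (rule abs_sum_single[OF N])
      have E_zero: "E a = 0" if "g (2 * a) x = 0" "g (2 * a + 1) x = 0" for a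
        using that iterated_neg_tetris_zero unfolding E_def by simp
      fix a assume a: "a \<in> N n"
      let ?A = "(neg_tetris ^^ j n a) (g (2 * a))" and ?B = "(neg_tetris ^^ j n a) (g (2 * a + 1))"
      show "\<bar>D n a x - E a\<bar> \<le> 1"
      proof (cases "\<delta> n a = 1")
        case True
        then have "D n a x = E a" by (simp add: D_def E_def J_def)
        then show ?thesis by simp
      next
        case False
        then have "D n a x - E a = - (?A x + neg_tetris ?A x) - (?B x + neg_tetris ?B x)"
          using \<delta>[OF a] by (simp add: D_def E_def J_def)
        moreover have "?A x + neg_tetris ?A x = 0 \<or> ?B x + neg_tetris ?B x = 0"
          using block_seqs_disjoint[OF g, of "2 * a" "2 * a + 1" x]
          by (auto simp: iterated_neg_tetris_zero neg_tetris_apply)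
        ultimately show ?thesis using neg_tetris_close[of ?A x] neg_tetris_close[of ?B x] by auto
      qed
      fix b assume "D n a x - E a \<noteq> 0" "D n b x - E b \<noteq> 0"
      then have "g (2 * a) x \<noteq> 0 \<or> g (2 * a + 1) x \<noteq> 0" "g (2 * b) x \<noteq> 0 \<or> g (2 * b + 1) x \<noteq> 0"
        using D_zero E_zero by force+
      then obtain c d where "c \<in> {2 * a, 2 * a + 1}" "g c x \<noteq> 0" "d \<in> {2 * b, 2 * b + 1}" "g d x \<noteq> 0"
        by blast
      moreover have "c = d" using block_seqs_disjoint[OF g, of c d x] calculation by blast
      ultimately show "a = b" by auto
    qed
    ultimately show ?thesis by simp
  qed
  have "dist_FIN (Q n) (?Q' n) \<le> 1" for n
    unfolding dist_FIN_def
  proof (rule cSUP_least)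
    fix x
    show "real_of_int \<bar>Q n x - ?Q' n x\<bar> \<le> 1"
      using close[of n x] by (metis of_int_1 of_int_le_iff)
  qed simp
  then have "dist_seq Q ?Q' \<le> 1"
    unfolding dist_seq_def by (intro cSUP_least) auto
  moreover have "?Q' \<in> neg_subseqs k g"
    unfolding neg_subseqs_def
  proof (intro CollectI exI conjI allI ballI)
    show "?Q' = ?Q'" by (rule refl)
  qed (fact fin ord J J0)+
  ultimately show ?thesis by blast
qed

section \<open>The theorem for Souslin measurable colourings\<close>

theorem theorem1p2:
  fixes k r :: nat and c :: "(nat \<Rightarrow> nat \<Rightarrow> int) \<Rightarrow> nat"
  assumes "k \<ge> 1" and "r \<ge> 1"
    and "souslin_measurable_map (block_topology k) r c"
  shows "\<exists>i<r. \<exists>P \<in> block_seqs k \<infinity>.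
           block_subseqs_pm k P \<subseteq> enlargement k 1 (c -` {i} \<inter> block_seqs k \<infinity>)"
proof -
  obtain u where lay: "layered k u"
    using gowers_layers[OF assms(1)] unfolding layered_def by metis
  have ul: "ultra u" using layered_fin_ultra[OF lay] by (rule fin_ultraD)
  have c: "c ` block_seqs k \<infinity> \<subseteq> {..<r}"
    "\<And>i. i < r \<Longrightarrow> c -` {i} \<inter> block_seqs k \<infinity> \<in> souslin_sets (block_topology k)"
    using assms(3) by (auto simp: souslin_measurable_map_def topspace_block_topology)
  let ?X = "\<lambda>i. c -` {i} \<inter> block_seqs k \<infinity>"
  have "\<forall>i. \<exists>A. i < r \<longrightarrow> (\<forall>t. u (A t)) \<and> (branches [] A \<subseteq> ?X i \<or> branches [] A \<inter> ?X i = {})"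
    using decided_souslin_sets[OF ul c(2)] unfolding decided_def by blast
  then obtain A where A: "\<And>i t. i < r \<Longrightarrow> u (A i t)"
    "\<And>i. i < r \<Longrightarrow> branches [] (A i) \<subseteq> ?X i \<or> branches [] (A i) \<inter> ?X i = {}" by metis
  define B where "B t y \<longleftrightarrow> (\<forall>i\<in>{..<r}. A i t y)" for t y
  have uB: "u (B t)" for t
    unfolding B_def using A(1) by (simp add: ultra_ball[OF ul])
  have B_sub: "branches [] B \<subseteq> branches [] (A i)" if "i < r" for i
    by (rule branches_mono) (use that in \<open>simp add: B_def\<close>)
  obtain g where g: "g \<in> block_seqs k \<infinity>"
    and sub: "neg_subseqs k g \<subseteq> branches [] B"
    using generic_blocks_homogeneous[where A = B, OF lay uB assms(1)] by blast
  \<comment> \<open>The common tree meets the block sequences, namely in \<open>g\<close>; the colour of \<open>g\<close> is the one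
    for which the tree lies inside the colour class.\<close>
  have "g = (\<lambda>n m. \<Sum>i\<in>{n}. (neg_tetris ^^ 0) (g i) m)" by simp
  then have "g \<in> neg_subseqs k g"
    unfolding neg_subseqs_def
    by (intro CollectI exI[of _ "\<lambda>n. {n}"] exI[of _ "\<lambda>_ _. 0"]) simp
  then have "g \<in> branches [] B" using sub by blast
  define i where "i = c g"
  have ir: "i < r" using c(1) g by (auto simp: i_def)
  have "g \<in> branches [] (A i) \<inter> ?X i"
    using B_sub[OF ir] \<open>g \<in> branches [] B\<close> g by (auto simp: i_def)
  then have i: "branches [] B \<subseteq> ?X i" using A(2)[OF ir] B_sub[OF ir] by blast
  let ?P = "\<lambda>n. g (2 * n) + neg_tetris (g (2 * n + 1))"
  have "block_subseqs_pm k ?P \<subseteq> enlargement k 1 (?X i)"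
  proof
    fix Q assume Q: "Q \<in> block_subseqs_pm k ?P"
    then obtain Q' where Q': "Q' \<in> neg_subseqs k g" "dist_seq Q Q' \<le> 1"
      using approximate_subsequence[OF g assms(1)] by blast
    then have "Q' \<in> ?X i" using sub i by blast
    then show "Q \<in> enlargement k 1 (?X i)"
      using Q'(2) Q unfolding enlargement_def block_subseqs_pm_def by blast
  qed
  then show ?thesis using ir paired_block_seq[OF g assms(1)] by blast
qed

end
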